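(* Let $S^2=\{(x,y,z)\in\mathbb{R}^3 : x^2+y^2+z^2=1\}$ with the standard area (symplectic) form. For a positive real number $\epsilon$ let $C_\epsilon=\{(x,y,z)\in S^2 : z=\pm\epsilon\}$. Then $C_\epsilon$ is stably displaceable for any positive real number $\epsilon$, and there exists a positive real number $E$ such that $$C(S^2,C_\epsilon,R;e)=\infty$$ for any positive real number $\epsilon$ and any elements $R=(R_1,\ldots,R_n)\in(\mathbb{R}_{>0})^n$ and $e=(e_1,\ldots,e_n)\in\mathbb{Z}^n$ with $R_k>E$ and $e_k\neq0$ for some $k$.
   Context: Conventions. $S^1=\mathbb{R}/\mathbb{Z}$, $T^n=(\mathbb{R}/\mathbb{Z})^n$. The Hamiltonian vector field is defined by $\omega(X_H,V)=-dH(V)$; for compactly supported $H\colon S^1\times N\to\mathbb{R}$, $H_t=H(t,\cdot)$, and $\{\phi_H^t\}$ is the isotopy generated by $X_H^t=X_{H_t}$ with $\phi_H^0=\mathrm{id}$. For $\alpha\in[S^1,N]$, $\mathcal{P}(H;\alpha)$ is the set of smooth loops $z\colon S^1\to N$ in the free homotopy class $\alpha$ with $\dot z(t)=X_H^t(z(t))$. A subset $Z$ of a symplectic manifold $N$ is displaceable if $\bar Z\cap\phi_H^1(Z)=\emptyset$ for some compactly supported $H\colon S^1\times N\to\mathbb{R}$ ($\bar Z$ is the closure). A subset $X\subset M$ is stably displaceable if $X\times T^1$ is displaceable in $M\times T^*T^1$ (product symplectic form, $T^1$ the zero section). The capacity. For a compact subset $Y$ of an open symplectic manifold $N$ and $\alpha\in[S^1,N]$,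 $C_{BPS}(N,Y;\alpha)=\inf\{K>0 : \mathcal{P}(H;\alpha)\ne\emptyset \text{ for all } H\in C_c^\infty(S^1\times N)\text{ with }\inf_{S^1\times Y}H\ge K\}$ (with $\inf\emptyset=+\infty$). Let $I_R^n=\{p\in\mathbb{R}^n:|p_i|<R_i\ \forall i\}$, let $\omega_0=\sum_i dp_i\wedge dq_i$ on $I_R^n\times T^n$, and equip $M\times I_R^n\times T^n$ with $\mathrm{pr}_1^*\omega+\mathrm{pr}_2^*\omega_0$ ($\mathrm{pr}_1,\mathrm{pr}_2$ the projections to $M$ and $I_R^n\times T^n$). Then $C(M,X,R;e)=C_{BPS}(M\times I_R^n\times T^n,\ X\times T^n;\ (0_M,e))$, where $X\times T^n$ means $X\times\{0\}\times T^n$ and $(0_M,e)$ is the class of loops with contractible $M$-component and $T^n$-component of class $e$. *)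

theory Defs
  imports "HOL-Analysis.Analysis"
begin

section \<open>Smooth maps on embedded submanifolds\<close>

text \<open>
  Manifolds are embedded submanifolds \<open>N\<close> of an ambient real normed vector space. The ambient
  space may be infinite-dimensional (see \<open>rvec\<close> below), but every \<open>N\<close> that is used lies in a
  finite-dimensional subspace of it.
\<close>

fun Ck_on :: "nat \<Rightarrow> 'a::real_normed_vector set \<Rightarrow> ('a \<Rightarrow> 'b::real_normed_vector) \<Rightarrow> bool" where
  "Ck_on 0 U f \<longleftrightarrow> continuous_on U f"
| "Ck_on (Suc k) U f \<longleftrightarrow>
     (\<forall>x\<in>U. f differentiable (at x)) \<and> (\<forall>v. Ck_on k U (\<lambda>x. frechet_derivative f (at x) v))"

definition smooth_on :: "'a::real_normed_vector set \<Rightarrow> ('a \<Rightarrow> 'b::real_normed_vector) \<Rightarrow> bool" where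
  "smooth_on N f \<longleftrightarrow>
     (\<forall>x\<in>N. \<exists>U g. open U \<and> x \<in> U \<and> (\<forall>k. Ck_on k U g) \<and> (\<forall>y\<in>U \<inter> N. g y = f y))"

definition smooth_curve :: "'a::real_normed_vector set \<Rightarrow> (real \<Rightarrow> 'a) \<Rightarrow> bool" where
  "smooth_curve N \<gamma> \<longleftrightarrow> smooth_on UNIV \<gamma> \<and> range \<gamma> \<subseteq> N"

definition curve_through ::
    "'a::real_normed_vector set \<Rightarrow> 'a \<Rightarrow> 'a \<Rightarrow> (real \<Rightarrow> 'a) \<Rightarrow> bool" where
  "curve_through N x V \<gamma> \<longleftrightarrow>
     smooth_curve N \<gamma> \<and> \<gamma> 0 = x \<and> (\<gamma> has_vector_derivative V) (at 0)"

definition tangent_space :: "'a::real_normed_vector set \<Rightarrow> 'a \<Rightarrow> 'a set" where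
  "tangent_space N x = {V. \<exists>\<gamma>. curve_through N x V \<gamma>}"


section \<open>Hamiltonian dynamics\<close>

text \<open>
  A symplectic form on \<open>N\<close> is given by a function \<open>\<omega>\<close> such that \<open>\<omega> x V W\<close> is its value on the
  tangent vectors \<open>V\<close>, \<open>W\<close> at \<open>x\<close>; values elsewhere are irrelevant.
\<close>

type_synonym 'a form = "'a \<Rightarrow> 'a \<Rightarrow> 'a \<Rightarrow> real"

text \<open>
  \<open>X\<close> is the value at \<open>x\<close> of the Hamiltonian vector field of \<open>h\<close>, that is,
  \<open>\<omega>(X, V) = - dh(V)\<close> for all tangent vectors \<open>V\<close>. Here \<open>dh(V)\<close> is the derivative of \<open>h\<close> along any
  curve with velocity \<open>V\<close>.
\<close>

definition hamiltonian_vector ::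
    "'a::real_normed_vector set \<Rightarrow> 'a form \<Rightarrow> ('a \<Rightarrow> real) \<Rightarrow> 'a \<Rightarrow> 'a \<Rightarrow> bool" where
  "hamiltonian_vector N \<omega> h x X \<longleftrightarrow>
     X \<in> tangent_space N x \<and>
     (\<forall>V \<gamma>. curve_through N x V \<gamma> \<longrightarrow> ((\<lambda>s. h (\<gamma> s)) has_real_derivative - \<omega> x X V) (at 0))"

text \<open>
  Compactly supported smooth functions on \<open>S\<^sup>1 \<times> N\<close>, as functions that are 1-periodic in time.
  Since \<open>S\<^sup>1\<close> is compact, compact support means vanishing outside \<open>S\<^sup>1 \<times> K\<close> for a compact
  \<open>K \<subseteq> N\<close>.
\<close>

definition Cc_smooth :: "'a::real_normed_vector set \<Rightarrow> (real \<Rightarrow> 'a \<Rightarrow> real) set" where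
  "Cc_smooth N = {H. smooth_on (UNIV \<times> N) (\<lambda>(t, x). H t x) \<and>
     (\<forall>t. \<forall>x\<in>N. H (t + 1) x = H t x) \<and>
     (\<exists>K. compact K \<and> K \<subseteq> N \<and> (\<forall>t. \<forall>x\<in>N - K. H t x = 0))}"

definition integral_curve ::
    "'a::real_normed_vector set \<Rightarrow> 'a form \<Rightarrow> (real \<Rightarrow> 'a \<Rightarrow> real) \<Rightarrow> (real \<Rightarrow> 'a) \<Rightarrow> bool" where
  "integral_curve N \<omega> H z \<longleftrightarrow>
     (\<forall>t. z t \<in> N \<and>
       (\<exists>X. hamiltonian_vector N \<omega> (H t) (z t) X \<and> (z has_vector_derivative X) (at t)))"

definition hamiltonian_isotopy ::
    "'a::real_normed_vector set \<Rightarrow> 'a form \<Rightarrow> (real \<Rightarrow> 'a \<Rightarrow> real) \<Rightarrow> (real \<Rightarrow> 'a \<Rightarrow> 'a) \<Rightarrow> bool" where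
  "hamiltonian_isotopy N \<omega> H \<phi> \<longleftrightarrow>
     (\<forall>x\<in>N. \<phi> 0 x = x \<and> integral_curve N \<omega> H (\<lambda>t. \<phi> t x))"

definition displaceable :: "'a::real_normed_vector set \<Rightarrow> 'a form \<Rightarrow> 'a set \<Rightarrow> bool" where
  "displaceable N \<omega> Z \<longleftrightarrow>
     (\<exists>H\<in>Cc_smooth N. \<exists>\<phi>. hamiltonian_isotopy N \<omega> H \<phi> \<and> (N \<inter> closure Z) \<inter> \<phi> 1 ` Z = {})"

text \<open>A free homotopy class \<open>\<alpha> \<in> [S\<^sup>1, N]\<close> is represented by the set of loops that it consists of.\<close>

definition periodic_orbits ::
    "'a::real_normed_vector set \<Rightarrow> 'a form \<Rightarrow> (real \<Rightarrow> 'a \<Rightarrow> real) \<Rightarrow> (real \<Rightarrow> 'a) set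
      \<Rightarrow> (real \<Rightarrow> 'a) set" where
  "periodic_orbits N \<omega> H \<alpha> =
     {z \<in> \<alpha>. smooth_curve N z \<and> (\<forall>t. z (t + 1) = z t) \<and> integral_curve N \<omega> H z}"

definition C_BPS ::
    "'a::real_normed_vector set \<Rightarrow> 'a form \<Rightarrow> 'a set \<Rightarrow> (real \<Rightarrow> 'a) set \<Rightarrow> ereal" where
  "C_BPS N \<omega> Y \<alpha> = Inf {ereal K | K. K > 0 \<and>
     (\<forall>H\<in>Cc_smooth N. (INF (t, y)\<in>UNIV \<times> Y. ereal (H t y)) \<ge> ereal K
        \<longrightarrow> periodic_orbits N \<omega> H \<alpha> \<noteq> {})}"

definition product_form :: "'a form \<Rightarrow> 'b form \<Rightarrow> ('a \<times> 'b) form" where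
  "product_form \<omega> \<omega>' = (\<lambda>(x, y) (V, V') (W, W'). \<omega> x V W + \<omega>' y V' W')"


section \<open>Cotangent bundles of tori\<close>

text \<open>
  To let the dimension \<open>n\<close> be quantified inside a statement, \<open>\<real>\<^sup>n\<close> and \<open>\<complex>\<^sup>n\<close> are realised in the
  Banach spaces of bounded sequences, as the sequences that vanish from index \<open>n\<close> on; coordinates
  are numbered from 0. The circle \<open>\<real>/\<int>\<close> is the unit circle of \<open>\<complex>\<close>, via \<open>q \<mapsto> exp(2\<pi>iq)\<close>.
\<close>

type_synonym rvec = "nat \<Rightarrow>\<^sub>C real"
type_synonym cvec = "nat \<Rightarrow>\<^sub>C complex"

definition euclid :: "nat \<Rightarrow> rvec set" where
  "euclid n = {p::rvec. \<forall>i\<ge>n. p i = 0}"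

definition box_R :: "nat \<Rightarrow> (nat \<Rightarrow> real) \<Rightarrow> rvec set" where
  "box_R n R = {p::rvec. p \<in> euclid n \<and> (\<forall>i<n. \<bar>p i\<bar> < R i)}"

definition torus :: "nat \<Rightarrow> cvec set" where
  "torus n = {w::cvec. (\<forall>i<n. cmod (w i) = 1) \<and> (\<forall>i\<ge>n. w i = 0)}"

text \<open>
  The one-form \<open>dq\<^sub>i\<close>: if \<open>w\<^sub>i = exp(2\<pi>iq\<^sub>i)\<close> then the velocity of \<open>w\<^sub>i\<close> is
  \<open>b\<^sub>i = 2\<pi>i q\<^sub>i' w\<^sub>i\<close>, hence \<open>q\<^sub>i' = Im (cnj w\<^sub>i * b\<^sub>i) / (2\<pi>)\<close>.
\<close>

definition dq :: "nat \<Rightarrow> cvec \<Rightarrow> cvec \<Rightarrow> real" where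
  "dq i w b = Im (cnj (w i) * b i) / (2 * pi)"

definition omega0 :: "nat \<Rightarrow> (rvec \<times> cvec) form" where
  "omega0 n = (\<lambda>(p, w) (a, b) (a', b'). \<Sum>i<n. a i * dq i w b' - dq i w b * a' i)"

definition torus_loop :: "nat \<Rightarrow> (nat \<Rightarrow> int) \<Rightarrow> real \<Rightarrow> cvec" where
  "torus_loop n e t = Bcontfun (\<lambda>i. if i < n then cis (2 * pi * of_int (e i) * t) else 0)"

lemma apply_torus_loop:
  "apply_bcontfun (torus_loop n e t) i = (if i < n then cis (2 * pi * of_int (e i) * t) else 0)"
proof -
  have "(\<lambda>i. if i < n then cis (2 * pi * of_int (e i) * t) else 0) \<in> bcontfun"
    unfolding bcontfun_def bounded_iff by (auto intro!: exI[of _ 1])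
  then show ?thesis
    by (simp add: torus_loop_def Bcontfun_inverse)
qed

definition stably_displaceable :: "'a::real_normed_vector set \<Rightarrow> 'a form \<Rightarrow> 'a set \<Rightarrow> bool" where
  "stably_displaceable M \<omega> X \<longleftrightarrow>
     displaceable (M \<times> (euclid 1 \<times> torus 1)) (product_form \<omega> (omega0 1)) (X \<times> ({0} \<times> torus 1))"

definition class_0e ::
    "'a::real_normed_vector set \<Rightarrow> nat \<Rightarrow> (nat \<Rightarrow> real) \<Rightarrow> (nat \<Rightarrow> int)
      \<Rightarrow> (real \<Rightarrow> 'a \<times> (rvec \<times> cvec)) set" where
  "class_0e M n R e = {z. path z \<and> pathfinish z = pathstart z \<and>
     path_image z \<subseteq> M \<times> (box_R n R \<times> torus n) \<and>
     (\<exists>m\<in>M. homotopic_loops M (fst \<circ> z) (\<lambda>_. m)) \<and>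
     homotopic_loops (torus n) (snd \<circ> snd \<circ> z) (torus_loop n e)}"

definition capacity ::
    "'a::real_normed_vector set \<Rightarrow> 'a form \<Rightarrow> 'a set \<Rightarrow> nat \<Rightarrow> (nat \<Rightarrow> real) \<Rightarrow> (nat \<Rightarrow> int)
      \<Rightarrow> ereal" where
  "capacity M \<omega> X n R e =
     C_BPS (M \<times> (box_R n R \<times> torus n)) (product_form \<omega> (omega0 n)) (X \<times> ({0} \<times> torus n))
       (class_0e M n R e)"


section \<open>The sphere\<close>

definition sphere2 :: "(real^3) set" where
  "sphere2 = {v. (v $ 1)\<^sup>2 + (v $ 2)\<^sup>2 + (v $ 3)\<^sup>2 = 1}"

text \<open>The Euclidean area form, for the orientation by the outward normal.\<close>

definition area_form :: "(real^3) form" where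
  "area_form v a b = v \<bullet> cross3 a b"

definition C_eps :: "real \<Rightarrow> (real^3) set" where
  "C_eps \<epsilon> = {v \<in> sphere2. v $ 3 = \<epsilon> \<or> v $ 3 = - \<epsilon>}"

end

theory Submission
  imports Defs "HOL-Complex_Analysis.Winding_Numbers"
begin

text \<open>
  Let \<open>v(q) = (cos 2\<pi>q, sin 2\<pi>q, 0)\<close> for \<open>q\<close> in the circle. On \<open>S\<^sup>2 \<times> T\<^sup>*S\<^sup>1\<close> the time-1 map of
  \<open>F = \<pi> (x \<bullet> v(q))\<close> leaves \<open>q\<close> fixed and turns the sphere by \<open>\<pi>\<close> about the axis \<open>v(q)\<close>, so it
  sends \<open>x\<^sub>3\<close> to \<open>-x\<^sub>3\<close>; since \<open>J = p - 2\<pi>x\<^sub>3\<close> is a first integral, it sends \<open>p\<close> to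
  \<open>p - 4\<pi>x\<^sub>3\<close>. As \<open>x\<^sub>3 \<noteq> 0\<close> on \<open>C\<^sub>\<epsilon>\<close>, a cutoff of \<open>F\<close> in \<open>p\<close> displaces \<open>C\<^sub>\<epsilon> \<times> S\<^sup>1\<close>.

  For the capacity, let \<open>f\<close> be a function of \<open>(p, J)\<close> that is huge on \<open>C\<^sub>\<epsilon> \<times> T\<^sup>n\<close> and vanishes
  unless \<open>\<bar>p\<^sub>k\<bar> \<le> \<delta> < \<bar>J\<bar>\<close>. The Hamiltonian \<open>f + b(t) F \<circ> (\<phi>\<^sub>f\<^sup>t)\<^sup>-\<^sup>1\<close> generates \<open>\<phi>\<^sub>f \<circ> \<phi>\<^sub>F\<close>, and
  \<open>p\<close> and \<open>x\<^sub>3\<close> are invariant under \<open>\<phi>\<^sub>f\<close>. A 1-periodic orbit that starts with \<open>\<bar>p\<^sub>k\<bar> \<le> \<delta>\<close>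
  therefore has \<open>x\<^sub>3 = -x\<^sub>3 = 0\<close>, hence \<open>J = p\<^sub>k\<close>, where \<open>f\<close> vanishes. So \<open>f\<close> never contributes
  to the winding in \<open>q\<^sub>k\<close>, and the contribution of \<open>F\<close> is less than 1 in absolute value if its
  cutoff in \<open>p\<^sub>k\<close> is flat enough; this flatness is what needs \<open>R\<^sub>k > E\<close>.
\<close>

section \<open>Smooth calculus: closure of the classes C^k under algebra and composition\<close>

section \<open>Calculus of smooth functions\<close>

text \<open>Replaces \<open>frechet_derivative\<close>, which is defined by choice, by any explicit
  derivative \<open>D\<close>; most inductions on k below go through this rule.\<close>

lemma Ck_on_Suc_UNIV_I:
  assumes "\<And>x. (f has_derivative D x) (at x)" "\<And>v. Ck_on k UNIV (\<lambda>x. D x v)"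
  shows "Ck_on (Suc k) UNIV f"
proof -
  have "frechet_derivative f (at x) = D x" for x
    using frechet_derivative_at[OF assms(1)] by simp
  then show ?thesis
    using assms by (auto simp: differentiable_def)
qed

lemma Ck_on_Suc_UNIV_D:
  assumes "Ck_on (Suc k) UNIV f"
  shows "(f has_derivative frechet_derivative f (at x)) (at x)"
    and "Ck_on k UNIV (\<lambda>x. frechet_derivative f (at x) v)"
  using assms by (auto simp: frechet_derivative_works)

lemma Ck_on_Suc_imp: "Ck_on (Suc k) UNIV f \<Longrightarrow> Ck_on k UNIV f"
proof (induction k arbitrary: f)
  case 0
  then show ?case
    by (auto simp: continuous_on_eq_continuous_at intro: differentiable_imp_continuous_within)
next
  case (Suc k)
  show ?case
    by (rule Ck_on_Suc_UNIV_I[OF Ck_on_Suc_UNIV_D(1)[OF Suc.prems]])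
       (rule Suc.IH[OF Ck_on_Suc_UNIV_D(2)[OF Suc.prems]])
qed

lemma Ck_on_const: "Ck_on k UNIV (\<lambda>x. c)"
proof (induction k arbitrary: c)
  case (Suc k)
  show ?case
    by (rule Ck_on_Suc_UNIV_I[where D = "\<lambda>x v. 0"]) (use Suc in auto)
qed simp

lemma Ck_on_add: "Ck_on k UNIV f \<Longrightarrow> Ck_on k UNIV g \<Longrightarrow> Ck_on k UNIV (\<lambda>x. f x + g x)"
proof (induction k arbitrary: f g)
  case 0
  then show ?case by (simp add: continuous_on_add)
next
  case (Suc k)
  show ?case
    by (rule Ck_on_Suc_UNIV_I[OF has_derivative_add[OF Ck_on_Suc_UNIV_D(1)[OF Suc.prems(1)]
          Ck_on_Suc_UNIV_D(1)[OF Suc.prems(2)]]])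
       (rule Suc.IH[OF Ck_on_Suc_UNIV_D(2)[OF Suc.prems(1)] Ck_on_Suc_UNIV_D(2)[OF Suc.prems(2)]])
qed

text \<open>By the Leibniz rule a directional derivative is a sum of two values of \<open>B\<close>,
  each with one factor undifferentiated; hence the induction also uses
  \<open>Ck_on_Suc_imp\<close>.\<close>

lemma Ck_on_bounded_bilinear:
  assumes "bounded_bilinear B"
  shows "Ck_on k UNIV f \<Longrightarrow> Ck_on k UNIV g \<Longrightarrow> Ck_on k UNIV (\<lambda>x. B (f x) (g x))"
proof (induction k arbitrary: f g)
  case 0
  then show ?case
    using bounded_bilinear.continuous_on[OF assms] by auto
next
  case (Suc k)
  show ?case
    by (rule Ck_on_Suc_UNIV_I[OF bounded_bilinear.FDERIV[OF assms Ck_on_Suc_UNIV_D(1)[OF Suc.prems(1)]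
          Ck_on_Suc_UNIV_D(1)[OF Suc.prems(2)]]])
       (intro Ck_on_add Suc.IH Ck_on_Suc_UNIV_D(2) Suc.prems Ck_on_Suc_imp[OF Suc.prems(1)]
          Ck_on_Suc_imp[OF Suc.prems(2)])
qed

lemma Ck_on_bounded_linear:
  assumes "bounded_linear L"
  shows "Ck_on k UNIV f \<Longrightarrow> Ck_on k UNIV (\<lambda>x. L (f x))"
proof (induction k arbitrary: f)
  case 0
  then show ?case
    using bounded_linear.continuous_on[OF assms] by auto
next
  case (Suc k)
  show ?case
    by (rule Ck_on_Suc_UNIV_I[OF bounded_linear.has_derivative[OF assms Ck_on_Suc_UNIV_D(1)[OF Suc.prems]]])
       (intro Suc.IH Ck_on_Suc_UNIV_D(2) Suc.prems)
qed

lemma Ck_on_ident: "Ck_on k UNIV (\<lambda>x. x)"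
proof (cases k)
  case (Suc m)
  show ?thesis unfolding Suc
    by (rule Ck_on_Suc_UNIV_I[where D = "\<lambda>x v. v"]) (auto intro: Ck_on_const)
qed simp

lemmas Ck_on_mult = Ck_on_bounded_bilinear[OF bounded_bilinear_mult]
  and Ck_on_scaleR = Ck_on_bounded_bilinear[OF bounded_bilinear_scaleR]

lemma Ck_on_uminus: "Ck_on k UNIV f \<Longrightarrow> Ck_on k UNIV (\<lambda>x. - f x)"
  by (rule Ck_on_bounded_linear[OF bounded_linear_minus[OF bounded_linear_ident]])

lemma Ck_on_diff: "Ck_on k UNIV f \<Longrightarrow> Ck_on k UNIV g \<Longrightarrow> Ck_on k UNIV (\<lambda>x. f x - g x)"
  using Ck_on_add[OF _ Ck_on_uminus, of k f g] by simp

lemma Ck_on_power: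
  fixes f :: "'a::real_normed_vector \<Rightarrow> real"
  shows "Ck_on k UNIV f \<Longrightarrow> Ck_on k UNIV (\<lambda>x. f x ^ m)"
  by (induction m) (auto intro: Ck_on_const Ck_on_mult)

lemma Ck_on_sum: "(\<And>i. i \<in> I \<Longrightarrow> Ck_on k UNIV (f i)) \<Longrightarrow> Ck_on k UNIV (\<lambda>x. \<Sum>i\<in>I. f i x)"
  by (induction I rule: infinite_finite_induct) (auto intro: Ck_on_const Ck_on_add)

lemma Ck_on_prod:
  fixes f :: "'i \<Rightarrow> 'a::real_normed_vector \<Rightarrow> real"
  shows "(\<And>i. i \<in> I \<Longrightarrow> Ck_on k UNIV (f i)) \<Longrightarrow> Ck_on k UNIV (\<lambda>x. \<Prod>i\<in>I. f i x)"
  by (induction I rule: infinite_finite_induct) (auto intro: Ck_on_const Ck_on_mult)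

text \<open>The derivative of a function of one variable is multiplication by a number, so a
  directional derivative of the composition is \<open>\<phi>'\<close> composed with
  \<open>g\<close>, times a directional derivative of \<open>g\<close>. Both factors are one class
  lower.\<close>

lemma Ck_on_compose_real:
  fixes \<phi> :: "real \<Rightarrow> real" and g :: "'a::real_normed_vector \<Rightarrow> real"
  shows "Ck_on k UNIV \<phi> \<Longrightarrow> Ck_on k UNIV g \<Longrightarrow> Ck_on k UNIV (\<lambda>x. \<phi> (g x))"
proof (induction k arbitrary: \<phi> g)
  case 0
  then show ?case
    using continuous_on_compose2[of UNIV \<phi> UNIV g] by auto
next
  case (Suc k)
  note \<phi> = Ck_on_Suc_UNIV_D[OF Suc.prems(1)] and g = Ck_on_Suc_UNIV_D[OF Suc.prems(2)]
  have eq: "frechet_derivative \<phi> (at y) v = frechet_derivative \<phi> (at y) 1 * v" for y v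
    using linear_scale[OF has_derivative_linear[OF \<phi>(1)], of y v 1] by simp
  show ?case
  proof (rule Ck_on_Suc_UNIV_I)
    show "((\<lambda>x. \<phi> (g x)) has_derivative
        (\<lambda>v. frechet_derivative \<phi> (at (g x)) 1 * frechet_derivative g (at x) v)) (at x)" for x
      using has_derivative_compose[OF g(1) \<phi>(1), of x] by (subst (asm) eq)
    show "Ck_on k UNIV (\<lambda>x. frechet_derivative \<phi> (at (g x)) 1 * frechet_derivative g (at x) v)" for v
      by (intro Ck_on_mult Suc.IH[of "\<lambda>y. frechet_derivative \<phi> (at y) 1"] \<phi>(2) g(2)
            Ck_on_Suc_imp[OF Suc.prems(2)])
  qed
qed

lemma Ck_on_Suc_real_I:
  fixes f :: "real \<Rightarrow> real"
  assumes "\<And>x. (f has_real_derivative f' x) (at x)" "Ck_on k UNIV f'"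
  shows "Ck_on (Suc k) UNIV f"
  by (rule Ck_on_Suc_UNIV_I[OF assms(1)[unfolded has_field_derivative_def]])
     (intro Ck_on_mult assms(2) Ck_on_const)

lemma Ck_on_sin_cos: "Ck_on k UNIV (sin :: real \<Rightarrow> real) \<and> Ck_on k UNIV (cos :: real \<Rightarrow> real)"
proof (induction k)
  case 0
  then show ?case by (simp add: continuous_on_sin continuous_on_cos)
next
  case (Suc k)
  then show ?case
    by (auto simp del: Ck_on.simps intro!: Ck_on_Suc_real_I[where f = sin and f' = cos]
        Ck_on_Suc_real_I[where f = cos and f' = "\<lambda>x. - sin x"] Ck_on_uminus DERIV_sin DERIV_cos)
qed

lemma Ck_on_deriv:
  fixes f :: "real \<Rightarrow> real"
  assumes "\<And>k. Ck_on k UNIV f"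
  shows "(f has_real_derivative deriv f x) (at x)" and "Ck_on k UNIV (deriv f)"
proof -
  have d: "f differentiable (at y)" for y
    using assms[of 1] by simp
  then have D: "(f has_real_derivative deriv f y) (at y)" for y
    by (simp add: DERIV_deriv_iff_real_differentiable)
  then show "(f has_real_derivative deriv f x) (at x)" .
  have "frechet_derivative f (at y) 1 = deriv f y" for y
    using frechet_derivative_at[OF D[of y, unfolded has_field_derivative_def]] by (metis mult.right_neutral)
  then show "Ck_on k UNIV (deriv f)"
    using Ck_on_Suc_UNIV_D(2)[OF assms[of "Suc k"], of 1] by simp
qed

lemmas Ck_on_intros =
  Ck_on_const Ck_on_add Ck_on_ident Ck_on_mult Ck_on_scaleR Ck_on_uminus Ck_on_diff Ck_on_power
  Ck_on_sum Ck_on_prod Ck_on_compose_real[OF Ck_on_sin_cos[THEN conjunct1]]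
  Ck_on_compose_real[OF Ck_on_sin_cos[THEN conjunct2]]

lemma Ck_on_UNIV_subset: "Ck_on k UNIV f \<Longrightarrow> Ck_on k U f"
  by (induction k arbitrary: f) (auto intro: continuous_on_subset)

lemma smooth_on_Ck_UNIV: "(\<And>k. Ck_on k UNIV f) \<Longrightarrow> smooth_on N f"
  unfolding smooth_on_def by blast

section \<open>Plateau functions built from exp(-1/x)\<close>

section \<open>Bump functions\<close>

text \<open>The family p(1/x) exp(-1/x), extended by 0, is closed under differentiation, which
  exp(-1/x) alone is not; smoothness then is an induction over all \<open>p\<close> at once.\<close>

definition flat :: "real poly \<Rightarrow> real \<Rightarrow> real" where
  "flat p x = (if x > 0 then poly p (1 / x) * exp (- (1 / x)) else 0)"

lemma poly_exp_tendsto_0: "((\<lambda>y::real. poly p y * exp (- y)) \<longlongrightarrow> 0) at_top"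
proof -
  have "((\<lambda>y::real. \<Sum>i\<le>degree p. coeff p i * (y ^ i / exp y)) \<longlongrightarrow> (\<Sum>i\<le>degree p. coeff p i * 0)) at_top"
    by (intro tendsto_sum tendsto_mult tendsto_const tendsto_power_div_exp_0)
  then show ?thesis
    by (simp add: poly_altdef sum_distrib_right exp_minus divide_inverse mult.assoc)
qed

text \<open>For x > 0 the derivative is (p - p')(1/x) x^(-2) exp(-1/x), and
  \<open>[:0, 0, 1:]\<close> is the polynomial X^2 that absorbs x^(-2). At 0 the right difference
  quotient is (p X)(1/h) exp(-1/h), which tends to 0.\<close>

lemma flat_DERIV: "(flat p has_real_derivative flat ((p - pderiv p) * [:0, 0, 1:]) x) (at x)"
proof -
  consider "x > 0" | "x < 0" | "x = 0" by linarith
  then show ?thesis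
  proof cases
    case 1
    have "((\<lambda>x. poly p (1 / x) * exp (- (1 / x))) has_real_derivative
        flat ((p - pderiv p) * [:0, 0, 1:]) x) (at x)"
      using 1 by (auto intro!: derivative_eq_intros DERIV_chain2[OF poly_DERIV]
          simp: flat_def field_simps power2_eq_square)
    moreover have "eventually (\<lambda>y. y > 0) (nhds x)"
      using 1 by (intro eventually_nhds_in_open[of "{0<..}", simplified]) auto
    then have "eventually (\<lambda>y. poly p (1 / y) * exp (- (1 / y)) = flat p y) (nhds x)"
      by eventually_elim (simp add: flat_def)
    ultimately show ?thesis
      by (metis DERIV_cong_ev)
  next
    case 2
    have "eventually (\<lambda>y. y < 0) (nhds x)"
      using 2 by (intro eventually_nhds_in_open[of "{..<0}", simplified]) auto
    then have "eventually (\<lambda>y. 0 = flat p y) (nhds x)"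
      by eventually_elim (simp add: flat_def)
    with 2 show ?thesis
      using DERIV_cong_ev[of x x "\<lambda>_. 0" "flat p" 0] by (simp add: flat_def)
  next
    case 3
    have "((\<lambda>h. flat p h / h) \<longlongrightarrow> 0) (at_right 0)"
    proof -
      have "((\<lambda>h. poly (p * [:0, 1:]) (inverse h) * exp (- inverse h)) \<longlongrightarrow> 0) (at_right 0)"
        by (rule filterlim_compose[OF poly_exp_tendsto_0 filterlim_inverse_at_top_right])
      moreover have "eventually (\<lambda>h. poly (p * [:0, 1:]) (inverse h) * exp (- inverse h) = flat p h / h)
          (at_right (0::real))"
        by (auto simp: eventually_at_right_field flat_def field_simps intro!: exI[of _ 1])
      ultimately show ?thesis
        by (rule Lim_transform_eventually)
    qed
    moreover have "((\<lambda>h. flat p h / h) \<longlongrightarrow> 0) (at_left 0)"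
      by (rule Lim_transform_eventually[OF tendsto_const])
         (auto simp: eventually_at_left_field flat_def intro!: exI[of _ "-1"])
    ultimately have "((\<lambda>h. flat p h / h) \<longlongrightarrow> 0) (at 0)"
      by (simp add: filterlim_at_split)
    then show ?thesis
      using 3 by (simp add: DERIV_def flat_def)
  qed
qed

lemma Ck_on_flat: "Ck_on k UNIV (flat p)"
proof (induction k arbitrary: p)
  case 0
  show ?case
    using DERIV_isCont[OF flat_DERIV] by (simp add: continuous_on_eq_continuous_at)
next
  case (Suc k)
  show ?case by (rule Ck_on_Suc_real_I[OF flat_DERIV Suc])
qed

abbreviation hump :: "real \<Rightarrow> real" where "hump \<equiv> flat 1"

lemma hump_pos: "x > 0 \<Longrightarrow> hump x > 0" and hump_nonpos: "x \<le> 0 \<Longrightarrow> hump x = 0"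
  and hump_nonneg: "hump x \<ge> 0"
  by (auto simp: flat_def)

lemma hump_mono: "x \<le> y \<Longrightarrow> hump x \<le> hump y"
  by (auto simp: flat_def field_simps)

text \<open>The inner quotient is 0 for |s| <= 1 and at least 1 for |s| >= 2, so the outer
  \<open>hump\<close> is normalised to 1 there and vanishes here. The square makes the function even
  and keeps it smooth at 0.\<close>

definition bump :: "real \<Rightarrow> real" where
  "bump s = hump (1 - hump (s\<^sup>2 - 1) / hump 3) / hump 1"

lemma Ck_on_bump: "Ck_on k UNIV bump"
proof -
  have "Ck_on k UNIV (\<lambda>s. hump (1 - hump (s\<^sup>2 - 1) * inverse (hump 3)) * inverse (hump 1))"
    by (intro Ck_on_mult Ck_on_const Ck_on_compose_real[OF Ck_on_flat] Ck_on_diff Ck_on_power Ck_on_ident)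
  then show ?thesis
    by (simp add: bump_def[abs_def] divide_inverse)
qed

lemma bump_eq_1: "\<bar>s\<bar> \<le> 1 \<Longrightarrow> bump s = 1"
  using hump_pos[of 1] by (simp add: bump_def hump_nonpos abs_square_le_1)

lemma bump_eq_0: "\<bar>s\<bar> \<ge> 2 \<Longrightarrow> bump s = 0"
proof -
  assume "\<bar>s\<bar> \<ge> 2"
  then have "s\<^sup>2 \<ge> 2\<^sup>2" by (metis abs_ge_zero abs_numeral abs_le_square_iff)
  then have "hump (s\<^sup>2 - 1) \<ge> hump 3" by (intro hump_mono) simp
  then have "1 - hump (s\<^sup>2 - 1) / hump 3 \<le> 0" using hump_pos[of 3] by simp
  then show ?thesis by (simp add: bump_def hump_nonpos)
qed

lemma bump_nonneg: "bump s \<ge> 0" and bump_le_1: "bump s \<le> 1"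
proof -
  show "bump s \<ge> 0" by (simp add: bump_def hump_nonneg)
  have "hump (1 - hump (s\<^sup>2 - 1) / hump 3) \<le> hump 1"
    by (intro hump_mono) (simp add: hump_nonneg)
  then show "bump s \<le> 1" using hump_pos[of 1] by (simp add: bump_def)
qed

lemma bump_deriv_eq_0:
  assumes "\<bar>s\<bar> < 1 \<or> 2 < \<bar>s\<bar>"
  shows "deriv bump s = 0"
proof -
  obtain c where "eventually (\<lambda>y. bump y = c) (nhds s)"
  proof (cases "\<bar>s\<bar> < 1")
    case True
    have "eventually (\<lambda>y. y \<in> {-1<..<1}) (nhds s)"
      using True by (intro eventually_nhds_in_open) auto
    then have "eventually (\<lambda>y. bump y = 1) (nhds s)"
      by eventually_elim (auto simp: bump_eq_1)
    then show thesis by (rule that)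
  next
    case False
    have "open ({..<-2} \<union> {2<..} :: real set)" by auto
    then have "eventually (\<lambda>y. y \<in> {..<-2} \<union> {2<..}) (nhds s)"
      using False assms by (intro eventually_nhds_in_open) (auto simp: abs_if split: if_splits)
    then have "eventually (\<lambda>y. bump y = 0) (nhds s)"
      by eventually_elim (auto intro!: bump_eq_0)
    then show thesis by (rule that)
  qed
  then have "deriv bump s = deriv (\<lambda>_. c) s" by (intro deriv_cong_ev) auto
  then show ?thesis by simp
qed

lemma bump_deriv_bounded: obtains D where "D > 0" "\<And>s. \<bar>deriv bump s\<bar> \<le> D"
proof -
  have "continuous_on {-2..2} (deriv bump)"
    using Ck_on_deriv(2)[OF Ck_on_bump, of 0] by (auto intro: continuous_on_subset)
  then have "bounded (deriv bump ` {-2..2})"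
    by (intro compact_imp_bounded compact_continuous_image) auto
  then obtain D where D: "\<And>s. s \<in> {-2..2} \<Longrightarrow> \<bar>deriv bump s\<bar> \<le> D"
    unfolding bounded_iff by (metis imageI real_norm_def)
  have "\<bar>deriv bump s\<bar> \<le> \<bar>D\<bar> + 1" for s
    using D[of s] bump_deriv_eq_0[of s] by (cases "\<bar>s\<bar> \<le> 2") (auto simp: abs_le_iff)
  then show thesis by (intro that[of "\<bar>D\<bar> + 1"]) auto
qed

text \<open>Serves as a Lipschitz constant for the slope of a cutoff, which occurs in the vector
  field of \<open>rotation_flow\<close>.\<close>

lemma bump_deriv2_bounded: obtains D where "\<And>s. \<bar>deriv (deriv bump) s\<bar> \<le> D"
proof -
  have outside: "deriv (deriv bump) s = 0" if "\<bar>s\<bar> > 2" for s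
  proof -
    have "open {y::real. \<bar>y\<bar> > 2}" by (intro open_Collect_less continuous_intros)
    then have "eventually (\<lambda>y. y \<in> {y. \<bar>y\<bar> > 2}) (nhds s)"
      using that by (intro eventually_nhds_in_open) auto
    then have "eventually (\<lambda>y. deriv bump y = 0) (nhds s)"
      by eventually_elim (auto intro: bump_deriv_eq_0)
    then have "deriv (deriv bump) s = deriv (\<lambda>_. 0) s" by (intro deriv_cong_ev) auto
    then show ?thesis by simp
  qed
  have "bounded (deriv (deriv bump) ` {-2..2})"
    using Ck_on_deriv(2)[OF Ck_on_deriv(2)[OF Ck_on_bump], of 0]
    by (intro compact_imp_bounded compact_continuous_image) (auto intro: continuous_on_subset)
  then obtain D where inside: "\<And>s. s \<in> {-2..2} \<Longrightarrow> \<bar>deriv (deriv bump) s\<bar> \<le> D"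
    unfolding bounded_iff by (metis imageI real_norm_def)
  have "\<bar>deriv (deriv bump) s\<bar> \<le> \<bar>D\<bar> + 1" for s
  proof (cases "\<bar>s\<bar> \<le> 2")
    case True
    then have "s \<in> {-2..2}" by auto
    then show ?thesis using inside[of s] by linarith
  next
    case False
    then show ?thesis using outside[of s] by linarith
  qed
  then show thesis by (rule that)
qed

lemma bump_antimono: "0 \<le> s \<Longrightarrow> s \<le> t \<Longrightarrow> bump t \<le> bump s"
  using hump_pos[of 1] hump_pos[of 3]
  by (auto simp: bump_def intro!: divide_right_mono hump_mono power_mono)

lemma bump_deriv_nonpos:
  assumes "s > 0"
  shows "deriv bump s \<le> 0"
proof -
  have "0 \<le> - deriv bump s"
  proof (rule mono_on_imp_deriv_nonneg)
    show "mono_on {0..} (\<lambda>s. - bump s)"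
      by (auto intro!: mono_onI bump_antimono)
    show "((\<lambda>s. - bump s) has_real_derivative - deriv bump s) (at s)"
      by (intro derivative_intros Ck_on_deriv(1)[OF Ck_on_bump])
  qed (use assms in auto)
  then show ?thesis by simp
qed

lemma scaled_bump_deriv:
  "((\<lambda>y. bump (c * y)) has_real_derivative deriv bump (c * y) * c) (at y)"
  by (rule DERIV_chain2[OF Ck_on_deriv(1)[OF Ck_on_bump]]) (auto intro!: derivative_eq_intros)

lemma Ck_on_scaled_bump: "Ck_on j UNIV (\<lambda>y. bump (c * y))"
  by (intro Ck_on_compose_real[OF Ck_on_bump] Ck_on_intros)

text \<open>A fixed bump is stretched until two things hold. The plateau contains every p_k
  reachable from |p_k| <= 1, because x_3 changes by at most 2 and p_k by 2 pi times as much. The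
  slope 1/4 keeps the winding caused by the cutoff at most pi/4, which is less than 1.\<close>

lemma wide_bump:
  obtains M where "M > 0" "\<And>y. \<bar>y\<bar> \<le> 1 + 4 * pi \<Longrightarrow> bump (1 / M * y) = 1 \<and> deriv (\<lambda>y. bump (1 / M * y)) y = 0"
    "\<And>y. \<bar>deriv (\<lambda>y. bump (1 / M * y)) y\<bar> \<le> 1 / 4"
proof -
  obtain D where D: "D > 0" "\<And>s. \<bar>deriv bump s\<bar> \<le> D" using bump_deriv_bounded by blast
  \<comment> \<open>18 exceeds 1 + 4 pi, which is below 17, and the summand 4 D makes D / M at most
    1/4.\<close>
  define M where "M = 18 + 4 * D"
  have M: "M > 0" using D by (simp add: M_def)
  have dM: "deriv (\<lambda>y. bump (1 / M * y)) y = deriv bump (1 / M * y) / M" for y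
    using DERIV_imp_deriv[OF scaled_bump_deriv[of "1 / M" y]] by simp
  show thesis
  proof (rule that[OF M])
    fix y :: real
    show "\<bar>deriv (\<lambda>y. bump (1 / M * y)) y\<bar> \<le> 1 / 4"
      using D(2)[of "1 / M * y"] M unfolding dM by (simp add: abs_mult field_simps) (simp add: M_def)
    assume "\<bar>y\<bar> \<le> 1 + 4 * pi"
    then have "\<bar>y\<bar> < M" using pi_less_4 D(1) unfolding M_def by linarith
    then have "\<bar>1 / M * y\<bar> < 1" using M by (simp add: abs_mult)
    then show "bump (1 / M * y) = 1 \<and> deriv (\<lambda>y. bump (1 / M * y)) y = 0"
      unfolding dM using bump_eq_1 bump_deriv_eq_0 by simp
  qed
qed

section \<open>Existence for all times of solutions of globally Lipschitz autonomous
  equations\<close>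

section \<open>Global solutions of ordinary differential equations\<close>

text \<open>
  The Picard operator is a contraction for the norm \<open>sup\<^sub>t exp(-2Lt)\<bar>y(t)\<bar>\<close>; the substitution
  \<open>y(t) = exp(2Lt) u(t)\<close> turns this into the supremum norm of bounded continuous functions.
\<close>

lemma global_solution_nonneg:
  fixes f :: "'a::banach \<Rightarrow> 'a"
  assumes lip: "\<And>x y. norm (f x - f y) \<le> L * norm (x - y)" and "L > 0"
  obtains y where "y 0 = x0"
    and "\<And>t. t \<ge> 0 \<Longrightarrow> (y has_vector_derivative f (y t)) (at t within {0..})"
proof -
  define M where "M = 2 * L"
  have M: "M > 0" using \<open>L > 0\<close> by (simp add: M_def)
  have cf: "continuous_on S f" for S
    by (rule lipschitz_on_continuous_on[of L])
       (use lip \<open>L > 0\<close> in \<open>auto simp: lipschitz_on_def dist_norm\<close>)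
  define g where "g u s = f (exp (M * s) *\<^sub>R apply_bcontfun u s)" for u :: "real \<Rightarrow>\<^sub>C 'a" and s
  have cg: "continuous_on S (g u)" for S u
    unfolding g_def by (intro continuous_on_compose2[OF cf[of UNIV]] continuous_intros) auto
  have ig: "g u integrable_on {0..t}" for u t
    by (rule integrable_continuous_real[OF cg])
  \<comment> \<open>The Picard map after the substitution; \<open>max 0 t\<close> extends it by the
    constant \<open>x0\<close> to negative times, so that it acts on functions on the whole
    line.\<close>
  define T where "T u t = exp (- M * max 0 t) *\<^sub>R (x0 + integral {0..max 0 t} (g u))" for u t
  have exp_int: "((\<lambda>s. exp (M * s)) has_integral (exp (M * t) - 1) / M) {0..t}" if "t \<ge> 0" for t
  proof -
    have "((\<lambda>s. exp (M * s)) has_integral (exp (M * t) / M - exp (M * 0) / M)) {0..t}"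
      using that M by (intro fundamental_theorem_of_calculus)
        (auto intro!: derivative_eq_intros simp flip: has_real_derivative_iff_has_vector_derivative)
    then show ?thesis by (simp add: diff_divide_distrib)
  qed
  \<comment> \<open>Integrating the Lipschitz bound against the weight gives the contraction
    constant L / M = 1/2.\<close>
  have diff: "norm (T u t - T v t) \<le> norm (u - v) / 2" for u v t
  proof -
    define m where "m = max 0 t"
    have m: "m \<ge> 0" by (simp add: m_def)
    have "norm (integral {0..m} (\<lambda>s. g u s - g v s)) \<le> integral {0..m} (\<lambda>s. L * norm (u - v) * exp (M * s))"
    proof (rule integral_norm_bound_integral)
      show "(\<lambda>s. g u s - g v s) integrable_on {0..m}" by (intro integrable_diff ig)
      show "(\<lambda>s. L * norm (u - v) * exp (M * s)) integrable_on {0..m}"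
        by (intro integrable_continuous_real continuous_intros)
      fix s
      have "norm (g u s - g v s) \<le> L * norm (exp (M * s) *\<^sub>R (u - v) s)"
        using lip[of "exp (M * s) *\<^sub>R u s" "exp (M * s) *\<^sub>R v s"]
        by (simp add: g_def scaleR_diff_right)
      also have "\<dots> = L * exp (M * s) * norm ((u - v) s)" by simp
      also have "\<dots> \<le> L * exp (M * s) * norm (u - v)"
        using \<open>L > 0\<close> by (intro mult_left_mono norm_bounded) auto
      finally show "norm (g u s - g v s) \<le> L * norm (u - v) * exp (M * s)" by (simp add: mult_ac)
    qed
    also have "\<dots> = L * norm (u - v) * ((exp (M * m) - 1) / M)"
      using exp_int[OF m] by (simp add: integral_unique)
    also have "\<dots> \<le> norm (u - v) / 2 * exp (M * m)"
      using \<open>L > 0\<close> by (simp add: M_def field_simps mult_left_mono)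
    finally have I: "norm (integral {0..m} (\<lambda>s. g u s - g v s)) \<le> norm (u - v) / 2 * exp (M * m)" .
    have "T u t - T v t = exp (- M * m) *\<^sub>R integral {0..m} (\<lambda>s. g u s - g v s)"
      by (simp add: T_def m_def[symmetric] integral_diff ig scaleR_diff_right scaleR_add_right)
    then have "norm (T u t - T v t) = exp (- M * m) * norm (integral {0..m} (\<lambda>s. g u s - g v s))"
      by simp
    also have "\<dots> \<le> exp (- M * m) * (norm (u - v) / 2 * exp (M * m))"
      by (intro mult_left_mono I) auto
    also have "\<dots> = norm (u - v) / 2" by (simp add: exp_minus)
    finally show ?thesis .
  qed
  have dI: "((\<lambda>r. integral {0..r} (g u)) has_vector_derivative g u t) (at t within {0..})"
    if t: "t \<ge> 0" for u t
  proof -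
    have "((\<lambda>r. integral {0..r} (g u)) has_vector_derivative g u t) (at t within {0..t+1})"
      by (rule integral_has_vector_derivative[OF cg]) (use t in auto)
    moreover have "at t within {0..t+1} = at t within {0..}"
      by (rule at_within_nhd[of _ "{..<t+1}"]) auto
    ultimately show ?thesis by simp
  qed
  have cT: "continuous_on UNIV (T u)" for u
  proof -
    have "continuous_on {0..} (\<lambda>r. integral {0..r} (g u))"
      using has_vector_derivative_continuous[OF dI]
      by (auto simp: continuous_on_eq_continuous_within)
    then have "continuous_on UNIV (\<lambda>t. integral {0..max 0 t} (g u))"
      by (rule continuous_on_compose2) (auto intro!: continuous_intros)
    then show ?thesis
      unfolding T_def by (intro continuous_intros)
  qed
  \<comment> \<open>For u = 0 the integrand is the constant \<open>f 0\<close>, so the integral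
    grows linearly, which the weight absorbs by t exp(-M t) <= 1/M. The contraction estimate then
    bounds \<open>T u\<close> for every \<open>u\<close>.\<close>
  have T0: "norm (T 0 t) \<le> norm x0 + norm (f 0) / M" for t
  proof -
    define m where "m = max 0 t"
    have m: "m \<ge> 0" by (simp add: m_def)
    have "exp (M * m) \<ge> M * m" using exp_ge_add_one_self[of "M * m"] by linarith
    then have e: "m * exp (- M * m) \<le> 1 / M" using M by (simp add: exp_minus field_simps)
    have "g 0 = (\<lambda>_. f 0)" by (simp add: g_def fun_eq_iff)
    then have "norm (T 0 t) = exp (- M * m) * norm (x0 + m *\<^sub>R f 0)"
      using m by (simp add: T_def m_def[symmetric])
    also have "\<dots> \<le> exp (- M * m) * (norm x0 + m * norm (f 0))"
      using norm_triangle_ineq[of x0 "m *\<^sub>R f 0"] m by (intro mult_left_mono) auto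
    also have "\<dots> = exp (- M * m) * norm x0 + (m * exp (- M * m)) * norm (f 0)"
      by (simp add: algebra_simps)
    also have "\<dots> \<le> 1 * norm x0 + 1 / M * norm (f 0)"
      using m M e by (intro add_mono mult_right_mono) auto
    finally show ?thesis by simp
  qed
  have T_bcontfun: "T u \<in> bcontfun" for u
  proof (rule bcontfun_normI[OF cT])
    fix t
    have "norm (T u t) \<le> norm (T 0 t) + norm (T u t - T 0 t)" by (rule norm_triangle_sub)
    then show "norm (T u t) \<le> norm x0 + norm (f 0) / M + norm u / 2"
      using T0[of t] diff[of u t 0] by simp
  qed
  have "\<exists>!u. Bcontfun (T u) = u"
  proof (rule banach_fix_type[where c = "1/2"], safe)
    show "dist (Bcontfun (T u)) (Bcontfun (T v)) \<le> 1 / 2 * dist u v" for u v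
    proof -
      have "norm (Bcontfun (T u) - Bcontfun (T v)) \<le> norm (u - v) / 2"
        by (rule norm_bound) (simp only: minus_bcontfun.rep_eq Bcontfun_inverse[OF T_bcontfun] diff)
      then show ?thesis by (simp add: dist_norm)
    qed
  qed auto
  then obtain u where "Bcontfun (T u) = u" by blast
  then have u: "apply_bcontfun u t = T u t" for t
    using Bcontfun_inverse[OF T_bcontfun] by metis
  define y where "y t = x0 + integral {0..t} (g u)" for t
  have y: "exp (M * t) *\<^sub>R apply_bcontfun u t = y t" if "t \<ge> 0" for t
    using that by (simp add: u T_def y_def exp_minus)
  show thesis
  proof (rule that[of y])
    show "y 0 = x0" by (simp add: y_def)
    fix t :: real assume t: "t \<ge> 0"
    have "(y has_vector_derivative g u t) (at t within {0..})"
      unfolding y_def[abs_def] using dI[OF t] by (auto intro!: derivative_eq_intros)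
    then show "(y has_vector_derivative f (y t)) (at t within {0..})"
      by (simp add: g_def y[OF t])
  qed
qed

text \<open>Negative times come from a forward solution for \<open>- f\<close> run backwards. Both
  halves leave \<open>x0\<close> with the velocity \<open>f x0\<close>, so the glued curve is
  differentiable at 0.\<close>

lemma global_solution:
  fixes f :: "'a::banach \<Rightarrow> 'a"
  assumes lip: "\<And>x y. norm (f x - f y) \<le> L * norm (x - y)"
  obtains y where "y 0 = x0" and "\<And>t. (y has_vector_derivative f (y t)) (at t)"
proof -
  have "norm (f x - f y) \<le> (\<bar>L\<bar> + 1) * norm (x - y)" for x y
    by (rule order_trans[OF lip mult_right_mono]) auto
  then have lip': "norm (f x - f y) \<le> (\<bar>L\<bar> + 1) * norm (x - y)"
      "norm (- f x - - f y) \<le> (\<bar>L\<bar> + 1) * norm (x - y)" for x y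
    by (simp_all add: norm_minus_commute)
  have L: "\<bar>L\<bar> + 1 > 0" by simp
  obtain y where y: "y 0 = x0"
      "\<And>t. t \<ge> 0 \<Longrightarrow> (y has_vector_derivative f (y t)) (at t within {0..})"
    using global_solution_nonneg[OF lip'(1) L] by blast
  obtain z where z: "z 0 = x0"
      "\<And>t. t \<ge> 0 \<Longrightarrow> (z has_vector_derivative - f (z t)) (at t within {0..})"
    using global_solution_nonneg[of "\<lambda>x. - f x", OF lip'(2) L] by blast
  have z': "((\<lambda>t. z (- t)) has_vector_derivative f (z (- t))) (at t within {..0})" if "t \<le> 0" for t
  proof -
    have "((z \<circ> uminus) has_vector_derivative (- 1) *\<^sub>R - f (z (- t))) (at t within {..0})"
      by (rule vector_diff_chain_within)
         (use that z(2)[of "- t"] in \<open>auto intro!: derivative_eq_intros\<close>)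
    then show ?thesis by (simp add: o_def)
  qed
  define w where "w t = (if t \<in> {0..} then y t else z (- t))" for t :: real
  have "(w has_vector_derivative f (w t)) (at t)" for t
  proof -
    have cl: "closure {0..} \<inter> closure {..0} = {0::real}" by auto
    have Un: "{0..} \<union> {0} = {0::real..}" "{..0} \<union> {0} = {..0::real}" by auto
    have "((\<lambda>t. if t \<in> {0..} then y t else z (- t)) has_vector_derivative
        (if t \<in> {0..} then f (y t) else f (z (- t)))) (at t within UNIV)"
      by (rule has_vector_derivative_If_within_closures[where T = "{..0}"], unfold cl Un)
         (use y z z' in auto)
    then show ?thesis by (cases "0 \<le> t") (simp_all add: w_def[abs_def])
  qed
  then show thesis
    using y(1) by (intro that[of w]) (auto simp: w_def)
qed

section \<open>Coordinates and compactness in the sequence models of R^n and C^n\<close>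

section \<open>Bounded sequences\<close>

definition unit_seq :: "nat \<Rightarrow> 'b::real_normed_vector \<Rightarrow> nat \<Rightarrow>\<^sub>C 'b" where
  "unit_seq i c = Bcontfun (\<lambda>j. if j = i then c else 0)"

lemma apply_unit_seq [simp]: "apply_bcontfun (unit_seq i c) j = (if j = i then c else 0)"
proof -
  have "(\<lambda>j. if j = i then c else 0) \<in> bcontfun"
    unfolding bcontfun_def bounded_iff by (auto intro!: exI[of _ "norm c"])
  then show ?thesis
    by (simp add: unit_seq_def Bcontfun_inverse)
qed

lemma bounded_linear_unit_seq: "bounded_linear (unit_seq i)"
proof (rule bounded_linear_intro[where K = 1])
  show "norm (unit_seq i c) \<le> norm c * 1" for c
    by (rule norm_bound) auto
qed (auto intro!: bcontfun_eqI)

lemma bounded_linear_apply_bcontfun: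
  "bounded_linear (\<lambda>f::'a::topological_space \<Rightarrow>\<^sub>C 'b::real_normed_vector. apply_bcontfun f i)"
  by (rule bounded_linear_intro[where K = 1]) (auto intro: norm_bounded)

lemma apply_bcontfun_sum [simp]:
  "apply_bcontfun (\<Sum>i\<in>I. f i) j = (\<Sum>i\<in>I. apply_bcontfun (f i) j)"
  by (rule linear_sum[OF bounded_linear.linear[OF bounded_linear_apply_bcontfun]])

text \<open>The ambient space is infinite-dimensional, so closed and bounded would not suffice.
  Instead, appending one coordinate exhibits the set as a continuous image of a product of compact
  sets.\<close>

lemma compact_finite_seq:
  assumes "\<And>i. i < n \<Longrightarrow> compact (S i)"
  shows "compact {v::nat \<Rightarrow>\<^sub>C 'b::real_normed_vector. (\<forall>i<n. v i \<in> S i) \<and> (\<forall>i\<ge>n. v i = 0)}"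
  using assms
proof (induction n)
  case 0
  have "{v::nat \<Rightarrow>\<^sub>C 'b. \<forall>i. v i = 0} = {0}"
    by (auto intro: bcontfun_eqI)
  then show ?case by simp
next
  case (Suc n)
  let ?V = "\<lambda>n. {v::nat \<Rightarrow>\<^sub>C 'b. (\<forall>i<n. v i \<in> S i) \<and> (\<forall>i\<ge>n. v i = 0)}"
  have "compact ((\<lambda>(v, c). v + unit_seq n c) ` (?V n \<times> S n))"
    unfolding split_beta
    by (intro compact_continuous_image compact_Times Suc continuous_intros
        bounded_linear.continuous_on[OF bounded_linear_unit_seq]) auto
  moreover have "(\<lambda>(v, c). v + unit_seq n c) ` (?V n \<times> S n) = ?V (Suc n)"
  proof (intro set_eqI iffI)
    fix v assume v: "v \<in> ?V (Suc n)"
    have "v = (v - unit_seq n (v n)) + unit_seq n (v n)" by simp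
    moreover have "(v - unit_seq n (v n), v n) \<in> ?V n \<times> S n"
      using v by (auto simp: not_less_eq_eq)
    ultimately show "v \<in> (\<lambda>(v, c). v + unit_seq n c) ` (?V n \<times> S n)"
      by (metis (no_types, lifting) case_prod_conv image_eqI)
  qed (auto simp: less_Suc_eq)
  ultimately show ?case by simp
qed

lemma torus_compact: "compact (torus n)"
proof -
  have "torus n = {w::cvec. (\<forall>i<n. w i \<in> sphere 0 1) \<and> (\<forall>i\<ge>n. w i = 0)}"
    by (auto simp: torus_def)
  then show ?thesis
    using compact_finite_seq[of n "\<lambda>_. sphere (0::complex) 1"] by simp
qed

lemma sphere2_iff: "x \<in> sphere2 \<longleftrightarrow> x \<bullet> x = 1"
  by (simp add: sphere2_def inner_vec_def sum_3 power2_eq_square)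

lemma sphere2_compact: "compact sphere2"
proof -
  have "sphere2 = sphere 0 1"
    by (auto simp: sphere2_iff norm_eq_sqrt_inner)
  then show ?thesis by (metis compact_sphere)
qed

section \<open>Tangent spaces and Hamilton's equations on S^2 x P x T^n\<close>

section \<open>Tangent vectors and Hamiltonian vectors\<close>

text \<open>Linear equations for the tangent space; \<open>curve_through_tangent_vector\<close> and
  \<open>tangent_vector_curve\<close> compare them with velocities of curves.\<close>

definition tangent_vector ::
    "nat \<Rightarrow> real^3 \<Rightarrow> cvec \<Rightarrow> real^3 \<Rightarrow> rvec \<Rightarrow> cvec \<Rightarrow> bool" where
  "tangent_vector n x w \<xi> a b \<longleftrightarrow> x \<bullet> \<xi> = 0 \<and> a \<in> euclid n \<and>
     (\<forall>i<n. Re (cnj (w i) * b i) = 0) \<and> (\<forall>i\<ge>n. b i = 0)"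

lemma has_vector_derivative_component:
  assumes "(\<gamma> has_vector_derivative V) F" "bounded_linear L"
  shows "((\<lambda>s. L (\<gamma> s)) has_vector_derivative L V) F"
  by (rule bounded_linear.has_vector_derivative[OF assms(2,1)])

lemmas bounded_linear_fst_snd =
  bounded_linear_fst
  bounded_linear_compose[OF bounded_linear_fst bounded_linear_snd]
  bounded_linear_compose[OF bounded_linear_snd bounded_linear_snd]

lemma curve_components:
  fixes \<gamma> :: "real \<Rightarrow> (real^3) \<times> (rvec \<times> cvec)"
  assumes "(\<gamma> has_vector_derivative (\<xi>, a, b)) F"
  shows "((\<lambda>s. fst (\<gamma> s)) has_vector_derivative \<xi>) F"
    and "((\<lambda>s. fst (\<gamma> s) $ j) has_real_derivative \<xi> $ j) F"
    and "((\<lambda>s. apply_bcontfun (fst (snd (\<gamma> s))) i) has_real_derivative a i) F"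
    and "((\<lambda>s. apply_bcontfun (snd (snd (\<gamma> s))) i) has_vector_derivative b i) F"
    and "((\<lambda>s. Re (apply_bcontfun (snd (snd (\<gamma> s))) i)) has_real_derivative Re (b i)) F"
    and "((\<lambda>s. Im (apply_bcontfun (snd (snd (\<gamma> s))) i)) has_real_derivative Im (b i)) F"
proof -
  note d = has_vector_derivative_component[OF assms]
  note w = bounded_linear_compose[OF bounded_linear_apply_bcontfun[of i] bounded_linear_fst_snd(3)]
  show "((\<lambda>s. fst (\<gamma> s)) has_vector_derivative \<xi>) F"
    using d[OF bounded_linear_fst_snd(1)] by simp
  show "((\<lambda>s. fst (\<gamma> s) $ j) has_real_derivative \<xi> $ j) F"
    using d[OF bounded_linear_compose[OF bounded_linear_vec_nth bounded_linear_fst_snd(1)]]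
    by (simp add: has_real_derivative_iff_has_vector_derivative)
  show "((\<lambda>s. apply_bcontfun (fst (snd (\<gamma> s))) i) has_real_derivative a i) F"
    using d[OF bounded_linear_compose[OF bounded_linear_apply_bcontfun bounded_linear_fst_snd(2)]]
    by (simp add: has_real_derivative_iff_has_vector_derivative)
  show "((\<lambda>s. apply_bcontfun (snd (snd (\<gamma> s))) i) has_vector_derivative b i) F"
    using d[OF w] by simp
  show "((\<lambda>s. Re (apply_bcontfun (snd (snd (\<gamma> s))) i)) has_real_derivative Re (b i)) F"
    using d[OF bounded_linear_compose[OF bounded_linear_Re w]]
    by (simp add: has_real_derivative_iff_has_vector_derivative)
  show "((\<lambda>s. Im (apply_bcontfun (snd (snd (\<gamma> s))) i)) has_real_derivative Im (b i)) F"
    using d[OF bounded_linear_compose[OF bounded_linear_Im w]]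
    by (simp add: has_real_derivative_iff_has_vector_derivative)
qed

text \<open>Differentiate the constraints |x| = 1, |w_i| = 1 and the vanishing of the coordinates
  from n on.\<close>

lemma curve_through_tangent_vector:
  fixes \<gamma> :: "real \<Rightarrow> (real^3) \<times> (rvec \<times> cvec)"
  assumes \<gamma>: "curve_through (sphere2 \<times> (P \<times> torus n)) (x, p, w) (\<xi>, a, b) \<gamma>" and P: "P \<subseteq> euclid n"
  shows "tangent_vector n x w \<xi> a b"
proof -
  have d: "(\<gamma> has_vector_derivative (\<xi>, a, b)) (at 0)" and 0: "\<gamma> 0 = (x, p, w)"
    and in_N: "\<And>s. fst (\<gamma> s) \<in> sphere2" "\<And>s. fst (snd (\<gamma> s)) \<in> euclid n"
      "\<And>s. snd (snd (\<gamma> s)) \<in> torus n"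
    using \<gamma> P by (auto simp: curve_through_def smooth_curve_def image_subset_iff mem_Times_iff)
  note dc = curve_components[OF d]
  have "x \<bullet> \<xi> = 0"
  proof -
    have "((\<lambda>s. fst (\<gamma> s) \<bullet> fst (\<gamma> s)) has_vector_derivative (x \<bullet> \<xi> + \<xi> \<bullet> x)) (at 0)"
      using bounded_bilinear.has_vector_derivative[OF bounded_bilinear_inner dc(1) dc(1)] 0 by simp
    moreover have "((\<lambda>s. fst (\<gamma> s) \<bullet> fst (\<gamma> s)) has_vector_derivative 0) (at 0)"
      using in_N(1) by (simp add: sphere2_iff)
    ultimately show ?thesis
      using vector_derivative_unique_at by (fastforce simp: inner_commute)
  qed
  moreover have "a i = 0" if "i \<ge> n" for i
  proof -
    have "((\<lambda>s. 0) has_real_derivative a i) (at 0)"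
      using dc(3)[of i] in_N(2) that by (simp add: euclid_def)
    then show ?thesis using DERIV_unique DERIV_const by (metis DERIV_unique DERIV_const)
  qed
  moreover have "b i = 0" if "i \<ge> n" for i
  proof -
    have "((\<lambda>s. 0) has_vector_derivative b i) (at 0)"
      using dc(4)[of i] in_N(3) that by (simp add: torus_def)
    then show ?thesis using vector_derivative_unique_at has_vector_derivative_const by blast
  qed
  moreover have "Re (cnj (w i) * b i) = 0" if "i < n" for i
  proof -
    have "((\<lambda>s. (Re (apply_bcontfun (snd (snd (\<gamma> s))) i))\<^sup>2 + (Im (apply_bcontfun (snd (snd (\<gamma> s))) i))\<^sup>2)
        has_real_derivative 2 * (Re (w i) * Re (b i) + Im (w i) * Im (b i))) (at 0)"
      by (rule derivative_eq_intros dc refl)+ (simp add: 0 algebra_simps)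
    moreover have "cmod (apply_bcontfun (snd (snd (\<gamma> s))) i) = 1" for s
      using in_N(3)[of s] that by (auto simp: torus_def)
    then have "(Re (apply_bcontfun (snd (snd (\<gamma> s))) i))\<^sup>2 + (Im (apply_bcontfun (snd (snd (\<gamma> s))) i))\<^sup>2 = 1" for s
      by (metis cmod_power2 power_one)
    ultimately have "2 * (Re (w i) * Re (b i) + Im (w i) * Im (b i)) = 0"
      using DERIV_unique[OF _ DERIV_const[of 1]] by simp
    then show ?thesis by simp
  qed
  ultimately show ?thesis
    by (auto simp: tangent_vector_def euclid_def)
qed

lemma Ck_on_Pair:
  "Ck_on k UNIV f \<Longrightarrow> Ck_on k UNIV g \<Longrightarrow> Ck_on k UNIV (\<lambda>x. (f x, g x))"
  using Ck_on_add[OF Ck_on_bounded_linear[of "\<lambda>a. (a, 0)" k f]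
      Ck_on_bounded_linear[of "\<lambda>b. (0, b)" k g]]
  by (simp add: bounded_linear_Pair bounded_linear_ident bounded_linear_zero)

lemma finite_seq_eq_sum:
  fixes v :: "nat \<Rightarrow>\<^sub>C 'b::real_normed_vector"
  assumes "\<And>i. i \<ge> n \<Longrightarrow> v i = 0"
  shows "v = (\<Sum>i<n. unit_seq i (v i))"
  using assms by (auto intro!: bcontfun_eqI simp: not_less)

text \<open>The curve moves along a great circle in the sphere, oscillates along \<open>a\<close> in
  P and rotates in each circle of the torus.\<close>

lemma tangent_vector_curve:
  assumes x: "x \<in> sphere2" and w: "w \<in> torus n"
    and V: "tangent_vector n x w \<xi> a b"
    and P: "\<eta> > 0" "\<And>s. \<bar>s\<bar> \<le> \<eta> \<Longrightarrow> p + s *\<^sub>R a \<in> P"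
  shows "\<exists>\<gamma>. curve_through (sphere2 \<times> (P \<times> torus n)) (x, p, w) (\<xi>, a, b) \<gamma>"
proof -
  define r where "r = norm \<xi>"
  define \<beta> where "\<beta> i = Im (cnj (w i) * b i)" for i
  \<comment> \<open>For \<open>\<xi> = 0\<close> also r = 0; division by zero gives 0, and the curve
    is constant.\<close>
  define \<gamma>1 where "\<gamma>1 s = cos (r * s) *\<^sub>R x + (sin (r * s) / r) *\<^sub>R \<xi>" for s
  \<comment> \<open>\<open>smooth_curve\<close> asks for a curve on the whole line; the sine
    confines it to the segment known to lie in P.\<close>
  define \<gamma>2 where "\<gamma>2 s = p + (\<eta> * sin (s / \<eta>)) *\<^sub>R a" for s
  define \<gamma>3 where "\<gamma>3 s = (\<Sum>i<n. cos (\<beta> i * s) *\<^sub>R unit_seq i (w i) + sin (\<beta> i * s) *\<^sub>R unit_seq i (\<i> * w i))" for s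
  have wi: "cmod (w i) = 1" if "i < n" for i using w that by (auto simp: torus_def)
  have x\<xi>: "x \<bullet> \<xi> = 0" and x1: "x \<bullet> x = 1" using V x by (auto simp: tangent_vector_def sphere2_iff)
  have "smooth_on UNIV (\<lambda>s. (\<gamma>1 s, \<gamma>2 s, \<gamma>3 s))"
    unfolding \<gamma>1_def \<gamma>2_def \<gamma>3_def divide_inverse
    by (intro smooth_on_Ck_UNIV Ck_on_Pair Ck_on_intros)
  moreover have "\<gamma>1 s \<in> sphere2" for s
  proof (cases "\<xi> = 0")
    case True
    then show ?thesis using x by (simp add: \<gamma>1_def r_def)
  next
    case False
    have "\<gamma>1 s \<bullet> \<gamma>1 s = (cos (r * s))\<^sup>2 + (sin (r * s))\<^sup>2 / r\<^sup>2 * (\<xi> \<bullet> \<xi>)"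
      using x\<xi> x1 by (simp add: \<gamma>1_def inner_add_left inner_add_right inner_commute[of \<xi> x] power2_eq_square)
    also have "\<xi> \<bullet> \<xi> = r\<^sup>2" by (simp add: r_def power2_norm_eq_inner)
    finally show ?thesis using False by (simp add: sphere2_iff r_def)
  qed
  moreover have "\<gamma>2 s \<in> P" for s
    unfolding \<gamma>2_def using P(1) by (intro P(2)) (simp add: abs_mult)
  moreover have "\<gamma>3 s \<in> torus n" for s
  proof -
    have "apply_bcontfun (\<gamma>3 s) i = (if i < n then cis (\<beta> i * s) * w i else 0)" for i
      by (simp add: \<gamma>3_def sum.distrib if_distrib cis.ctr complex_eq_iff algebra_simps cong: if_cong)
    then show ?thesis by (simp add: torus_def norm_mult wi)
  qed
  moreover have "(\<gamma>1 0, \<gamma>2 0, \<gamma>3 0) = (x, p, w)"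
    using finite_seq_eq_sum[of n w, symmetric] w by (simp add: \<gamma>1_def \<gamma>2_def \<gamma>3_def torus_def)
  moreover have "((\<lambda>s. (\<gamma>1 s, \<gamma>2 s, \<gamma>3 s)) has_vector_derivative (\<xi>, a, b)) (at 0)"
  proof (intro has_vector_derivative_Pair)
    show "(\<gamma>1 has_vector_derivative \<xi>) (at 0)"
      unfolding \<gamma>1_def[abs_def]
      by (cases "\<xi> = 0") (auto intro!: derivative_eq_intros simp: r_def)
    show "(\<gamma>2 has_vector_derivative a) (at 0)"
      unfolding \<gamma>2_def[abs_def] using P(1)
      by (auto intro!: derivative_eq_intros)
    have "(\<gamma>3 has_vector_derivative (\<Sum>i<n. \<beta> i *\<^sub>R unit_seq i (\<i> * w i))) (at 0)"
      unfolding \<gamma>3_def[abs_def]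
      by (auto intro!: derivative_eq_intros)
    moreover have "(\<Sum>i<n. \<beta> i *\<^sub>R unit_seq i (\<i> * w i)) = b"
    proof (rule bcontfun_eqI)
      fix i
      have "b i = \<beta> i *\<^sub>R (\<i> * w i)" if "i < n"
      proof -
        have "w i * cnj (w i) * b i = b i"
          using wi[OF that] by (simp add: complex_norm_square[symmetric])
        moreover have "cnj (w i) * b i = \<i> * \<beta> i"
          using V that by (simp add: tangent_vector_def \<beta>_def complex_eq_iff)
        ultimately show ?thesis
          by (metis mult.assoc mult.commute scaleR_conv_of_real)
      qed
      then show "apply_bcontfun (\<Sum>i<n. \<beta> i *\<^sub>R unit_seq i (\<i> * w i)) i = b i"
        using V by (auto simp: tangent_vector_def not_less if_distrib cong: if_cong)
    qed
    ultimately show "(\<gamma>3 has_vector_derivative b) (at 0)" by simp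
  qed
  ultimately show ?thesis
    by (intro exI[of _ "\<lambda>s. (\<gamma>1 s, \<gamma>2 s, \<gamma>3 s)"]) (auto simp: curve_through_def smooth_curve_def)
qed

lemma dq_0: "dq i w 0 = 0"
  by (simp add: dq_def)

lemma dq_unit_seq:
  fixes w :: cvec
  shows   "dq i w (unit_seq j (2 * complex_of_real pi * \<i> * w j)) = (if i = j then (cmod (w j))\<^sup>2 else 0)"
  unfolding cmod_power2 by (simp add: dq_def power2_eq_square field_simps)

text \<open>Hamilton's equations, with \<open>G\<close>, \<open>hp\<close>, \<open>hq\<close> the
  partial derivatives of \<open>h\<close>. The sphere part rests on the identity that x . ((x cross
  G) cross v) = - G . v for v orthogonal to x. Necessity follows by testing with tangent vectors in
  each factor, all realised by curves.\<close>

lemma hamiltonian_vector_iff: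
  fixes G :: "real^3"
  assumes z: "x \<in> sphere2" "w \<in> torus n" and P: "P \<subseteq> euclid n"
    and P_open: "\<And>a. a \<in> euclid n \<Longrightarrow> \<exists>\<eta>>0. \<forall>s. \<bar>s\<bar> \<le> \<eta> \<longrightarrow> p + s *\<^sub>R a \<in> P"
    and grad: "\<And>\<gamma> \<xi> a b. curve_through (sphere2 \<times> (P \<times> torus n)) (x, p, w) (\<xi>, a, b) \<gamma> \<Longrightarrow>
      ((\<lambda>s. h (\<gamma> s)) has_real_derivative
        G \<bullet> \<xi> + (\<Sum>i<n. hp i * apply_bcontfun a i + hq i * dq i w b)) (at 0)"
  shows "hamiltonian_vector (sphere2 \<times> (P \<times> torus n)) (product_form area_form (omega0 n)) h (x, p, w) (\<xi>, a, b) \<longleftrightarrow>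
    tangent_vector n x w \<xi> a b \<and> \<xi> = cross3 x G \<and> (\<forall>i<n. a i = - hq i \<and> dq i w b = hp i)"
    (is "?H \<longleftrightarrow> ?T \<and> ?E")
proof -
  let ?N = "sphere2 \<times> (P \<times> torus n)"
  have curve: "\<exists>\<gamma>. curve_through ?N (x, p, w) (\<xi>, a, b) \<gamma>" if V: "tangent_vector n x w \<xi> a b" for \<xi> a b
  proof -
    obtain \<eta> where "\<eta> > 0" "\<And>s. \<bar>s\<bar> \<le> \<eta> \<Longrightarrow> p + s *\<^sub>R a \<in> P"
      using P_open V by (meson tangent_vector_def)
    then show ?thesis by (rule tangent_vector_curve[OF z V])
  qed
  have x1: "x \<bullet> x = 1" using z by (simp add: sphere2_iff)
  have \<omega>: "product_form area_form (omega0 n) (x, p, w) (\<xi>, a, b) (\<xi>', a', b') =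
      x \<bullet> cross3 \<xi> \<xi>' + (\<Sum>i<n. a i * dq i w b' - dq i w b * a' i)" for \<xi> a b \<xi>' a' b'
    by (simp add: product_form_def area_form_def omega0_def)
  have cr: "x \<bullet> cross3 (cross3 x u) v = (x \<bullet> u) * (x \<bullet> v) - (x \<bullet> x) * (u \<bullet> v)" for u v :: "real^3"
    by (simp add: cross3_simps)
  show ?thesis
  proof
    assume R: "?T \<and> ?E"
    then have E: "\<xi> = cross3 x G" "\<And>i. i < n \<Longrightarrow> a i = - hq i \<and> dq i w b = hp i" by auto
    have "((\<lambda>s. h (\<gamma> s)) has_real_derivative - product_form area_form (omega0 n) (x, p, w) (\<xi>, a, b) V) (at 0)"
      if \<gamma>: "curve_through ?N (x, p, w) V \<gamma>" for V \<gamma>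
    proof -
      obtain \<xi>' a' b' where V: "V = (\<xi>', a', b')" by (cases V) auto
      have "x \<bullet> \<xi>' = 0"
        using curve_through_tangent_vector[OF \<gamma>[unfolded V] P] by (simp add: tangent_vector_def)
      then have "- (x \<bullet> cross3 \<xi> \<xi>') = G \<bullet> \<xi>'" by (simp add: E(1) cr x1)
      moreover have "- (\<Sum>i<n. a i * dq i w b' - dq i w b * a' i) = (\<Sum>i<n. hp i * a' i + hq i * dq i w b')"
        unfolding sum_negf[symmetric] by (rule sum.cong) (auto simp: E(2))
      ultimately have "G \<bullet> \<xi>' + (\<Sum>i<n. hp i * a' i + hq i * dq i w b') =
          - product_form area_form (omega0 n) (x, p, w) (\<xi>, a, b) V"
        by (simp add: V \<omega>)
      then show ?thesis using grad[OF \<gamma>[unfolded V]] by (simp only:)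
    qed
    then show ?H
      using R curve by (auto simp: hamiltonian_vector_def tangent_space_def)
  next
    assume H: ?H
    then have T: ?T
      using curve_through_tangent_vector[OF _ P] by (auto simp: hamiltonian_vector_def tangent_space_def)
    have eq: "G \<bullet> \<xi>' + (\<Sum>i<n. hp i * apply_bcontfun a' i + hq i * dq i w b') =
        - (x \<bullet> cross3 \<xi> \<xi>') - (\<Sum>i<n. a i * dq i w b' - dq i w b * a' i)"
      if V: "tangent_vector n x w \<xi>' a' b'" for \<xi>' a' b'
    proof -
      obtain \<gamma> where \<gamma>: "curve_through ?N (x, p, w) (\<xi>', a', b') \<gamma>" using curve[OF V] by blast
      then have "((\<lambda>s. h (\<gamma> s)) has_real_derivative
          - product_form area_form (omega0 n) (x, p, w) (\<xi>, a, b) (\<xi>', a', b')) (at 0)"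
        using H by (auto simp: hamiltonian_vector_def)
      from DERIV_unique[OF grad[OF \<gamma>] this] show ?thesis by (simp add: \<omega>)
    qed
    \<comment> \<open>The test vectors v cross x are tangent for every v; as both sides are
      orthogonal to x, this determines \<open>\<xi>\<close>.\<close>
    have "\<xi> \<bullet> v = cross3 x G \<bullet> v" for v
    proof -
      have "tangent_vector n x w (cross3 v x) 0 0"
        by (simp add: tangent_vector_def dot_cross_self euclid_def)
      from eq[OF this] have "G \<bullet> cross3 v x = - (x \<bullet> cross3 \<xi> (cross3 v x))"
        by (simp add: dq_def)
      also have "\<dots> = (x \<bullet> x) * (\<xi> \<bullet> v) - (x \<bullet> \<xi>) * (x \<bullet> v)"
        by (simp add: cross3_simps)
      also have "\<dots> = \<xi> \<bullet> v"
        using T x1 by (simp add: tangent_vector_def)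
      finally show ?thesis
        by (simp add: cross3_simps)
    qed
    then have "\<xi> = cross3 x G" by (metis vector_eq_rdot)
    moreover have "a i = - hq i" if i: "i < n" for i
    proof -
      \<comment> \<open>The velocity of q_i at unit speed: its value under dq_i is |w_i|^2 =
        1.\<close>
      have "tangent_vector n x w 0 0 (unit_seq i (2 * complex_of_real pi * \<i> * w i))"
        using i by (auto simp: tangent_vector_def euclid_def)
      from eq[OF this] i z(2) show ?thesis
        by (simp add: dq_unit_seq torus_def if_distrib[of "times c" for c] sum_negf cong: if_cong)
    qed
    moreover have "dq i w b = hp i" if i: "i < n" for i
    proof -
      have "tangent_vector n x w 0 (unit_seq i 1) 0"
        using i by (auto simp: tangent_vector_def euclid_def)
      from eq[OF this] i show ?thesis
        by (simp add: dq_0 if_distrib[of "times c" for c] sum_negf cong: if_cong)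
    qed
    ultimately show "?T \<and> ?E" using T by blast
  qed
qed

section \<open>Conserved quantity, half turn and winding in the k-th coordinate\<close>

section \<open>The reduced equations of motion\<close>

lemma has_real_derivative_0_const:
  fixes f :: "real \<Rightarrow> real"
  assumes "\<And>t. t \<in> {0..1} \<Longrightarrow> (f has_real_derivative 0) (at t within {0..1})" "t \<in> {0..1}"
  shows "f t = f 0"
proof -
  obtain c where "\<forall>t\<in>{0..1}. f t = c"
    using has_field_derivative_zero_constant[of "{0..1}" f] assms(1) by auto
  then show ?thesis using assms(2) by simp
qed

text \<open>The motion of x, p = p_k and w = w_k, with the cutoffs in the other momenta entering as
  the constants \<open>A\<close> and \<open>\<Lambda>\<close>. The flow of f = A a(p) d(J), J = p -
  2 pi x_3, turns w by the angle \<open>\<phi>\<close> relative to (x_1, x_2) in time t. F depends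
  only on this relative angle, so pulling it back amounts to replacing w by (\<open>C\<close>,
  \<open>S\<close>), which gives \<open>\<Lambda> * \<rho> * u1\<close>. \<open>u2\<close> is the
  derivative of \<open>u1\<close> by the angle of w; \<open>H3\<close> and \<open>Hp\<close> are the
  partial derivatives of the total Hamiltonian by x_3 and p.\<close>

locale reduced_flow =
  fixes A \<Lambda> :: real and a a' a'' d d' \<rho> \<rho>' :: "real \<Rightarrow> real" and b B :: "real \<Rightarrow> real"
    and x1 x2 x3 p wr wi :: "real \<Rightarrow> real"
    and \<phi> C S u1 u2 \<beta> H3 Hp :: "real \<Rightarrow> real"
  defines "\<phi> \<equiv> \<lambda>t. 2 * pi * t * A * a' (p t) * d (p t - 2 * pi * x3 t)"
    and "C \<equiv> \<lambda>t. wr t * cos (\<phi> t) + wi t * sin (\<phi> t)"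
    and "S \<equiv> \<lambda>t. wi t * cos (\<phi> t) - wr t * sin (\<phi> t)"
    and "u1 \<equiv> \<lambda>t. x1 t * C t + x2 t * S t"
    and "u2 \<equiv> \<lambda>t. x2 t * C t - x1 t * S t"
    and "\<beta> \<equiv> \<lambda>t. b t * \<Lambda> * \<rho> (p t)"
    and "H3 \<equiv> \<lambda>t. - 2 * pi * A * a (p t) * d' (p t - 2 * pi * x3 t)
      + \<beta> t * u2 t * (2 * pi * t * A * a' (p t) * (2 * pi * d' (p t - 2 * pi * x3 t)))"
    and "Hp \<equiv> \<lambda>t. A * (a' (p t) * d (p t - 2 * pi * x3 t) + a (p t) * d' (p t - 2 * pi * x3 t))
      + b t * \<Lambda> * \<rho>' (p t) * u1 t
      - \<beta> t * u2 t * (2 * pi * t * A *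
          (a'' (p t) * d (p t - 2 * pi * x3 t) + a' (p t) * d' (p t - 2 * pi * x3 t)))"
  assumes a: "\<And>y. (a has_real_derivative a' y) (at y)" "\<And>y. (a' has_real_derivative a'' y) (at y)"
    and d: "\<And>y. (d has_real_derivative d' y) (at y)"
    and \<rho>: "\<And>y. (\<rho> has_real_derivative \<rho>' y) (at y)" "continuous_on UNIV \<rho>'"
    and b: "\<And>t. t \<in> {0..1} \<Longrightarrow> (B has_real_derivative b t) (at t within {0..1})"
      "continuous_on {0..1} b" "\<And>t. t \<in> {0..1} \<Longrightarrow> b t \<ge> 0"
      "B 0 = 0" "B 1 = pi"
    and \<Lambda>: "0 \<le> \<Lambda>" "\<Lambda> \<le> 1"
    and x1: "\<And>t. t \<in> {0..1} \<Longrightarrow>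
      (x1 has_real_derivative x2 t * H3 t - x3 t * (\<beta> t * S t)) (at t within {0..1})"
    and x2: "\<And>t. t \<in> {0..1} \<Longrightarrow>
      (x2 has_real_derivative x3 t * (\<beta> t * C t) - x1 t * H3 t) (at t within {0..1})"
    and x3: "\<And>t. t \<in> {0..1} \<Longrightarrow>
      (x3 has_real_derivative x1 t * (\<beta> t * S t) - x2 t * (\<beta> t * C t)) (at t within {0..1})"
    and p: "\<And>t. t \<in> {0..1} \<Longrightarrow> (p has_real_derivative - (2 * pi * (\<beta> t * u2 t))) (at t within {0..1})"
    and wr: "\<And>t. t \<in> {0..1} \<Longrightarrow> (wr has_real_derivative - (2 * pi * Hp t * wi t)) (at t within {0..1})"
    and wi: "\<And>t. t \<in> {0..1} \<Longrightarrow> (wi has_real_derivative 2 * pi * Hp t * wr t) (at t within {0..1})"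
    and x_norm: "\<And>t. t \<in> {0..1} \<Longrightarrow> (x1 t)\<^sup>2 + (x2 t)\<^sup>2 + (x3 t)\<^sup>2 = 1"
    and w_norm: "\<And>t. t \<in> {0..1} \<Longrightarrow> (wr t)\<^sup>2 + (wi t)\<^sup>2 = 1"
begin

lemma x3_u2: "t \<in> {0..1} \<Longrightarrow> (x3 has_real_derivative - (\<beta> t * u2 t)) (at t within {0..1})"
  by (rule DERIV_cong[OF x3]) (auto simp: u2_def algebra_simps)

text \<open>J generates the simultaneous rotation of w and of the sphere about its vertical axis,
  under which the Hamiltonian is invariant.\<close>

lemma J_const: "t \<in> {0..1} \<Longrightarrow> p t - 2 * pi * x3 t = p 0 - 2 * pi * x3 0"
  by (rule has_real_derivative_0_const[where f = "\<lambda>t. p t - 2 * pi * x3 t"])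
     (auto intro!: derivative_eq_intros p x3_u2)

definition "D = d (p 0 - 2 * pi * x3 0)"
definition "D' = d' (p 0 - 2 * pi * x3 0)"

lemma d_J: "t \<in> {0..1} \<Longrightarrow> d (p t - 2 * pi * x3 t) = D" "t \<in> {0..1} \<Longrightarrow> d' (p t - 2 * pi * x3 t) = D'"
  by (simp_all only: J_const D_def D'_def)

lemma C_S_norm:
  assumes "t \<in> {0..1}"
  shows "(C t)\<^sup>2 + (S t)\<^sup>2 = 1"
proof -
  have "(C t)\<^sup>2 + (S t)\<^sup>2 = ((wr t)\<^sup>2 + (wi t)\<^sup>2) * ((cos (\<phi> t))\<^sup>2 + (sin (\<phi> t))\<^sup>2)"
    unfolding C_def S_def by algebra
  then show ?thesis using w_norm[OF assms] by simp
qed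

lemma x3_bound: "t \<in> {0..1} \<Longrightarrow> \<bar>x3 t\<bar> \<le> 1"
  using x_norm[of t] abs_square_le_1[of "x3 t"] zero_le_power2[of "x1 t"] zero_le_power2[of "x2 t"]
  by linarith

lemma u1_bound:
  assumes "t \<in> {0..1}"
  shows "\<bar>u1 t\<bar> \<le> 1"
proof -
  have "(u1 t)\<^sup>2 + (u2 t)\<^sup>2 = ((x1 t)\<^sup>2 + (x2 t)\<^sup>2) * ((C t)\<^sup>2 + (S t)\<^sup>2)"
    unfolding u1_def u2_def by algebra
  then have "(u1 t)\<^sup>2 + (u2 t)\<^sup>2 = (x1 t)\<^sup>2 + (x2 t)\<^sup>2"
    using C_S_norm[OF assms] by simp
  then have "(u1 t)\<^sup>2 \<le> 1"
    using x_norm[OF assms] zero_le_power2[of "u2 t"] zero_le_power2[of "x3 t"] by linarith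
  then show ?thesis by (simp add: abs_square_le_1)
qed

text \<open>As J is constant along the orbit, d(J) may be replaced by the number \<open>D\<close>
  before differentiating.\<close>

lemma \<phi>_deriv:
  assumes t: "t \<in> {0..1}"
  shows "(\<phi> has_real_derivative 2 * pi * A * a' (p t) * D
    + 2 * pi * t * A * (a'' (p t) * - (2 * pi * (\<beta> t * u2 t))) * D) (at t within {0..1})"
proof (rule has_field_derivative_transform_within[OF _ zero_less_one t])
  show "((\<lambda>t. 2 * pi * t * A * a' (p t) * D) has_real_derivative 2 * pi * A * a' (p t) * D
    + 2 * pi * t * A * (a'' (p t) * - (2 * pi * (\<beta> t * u2 t))) * D) (at t within {0..1})"
    by (auto intro!: derivative_eq_intros DERIV_chain2[OF a(2)] p[OF t] simp: algebra_simps)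
qed (auto simp: \<phi>_def d_J)

text \<open>2 pi \<open>G\<close> is the rate at which \<open>H3\<close> turns (x_1, x_2) about the
  vertical axis. The vector (\<open>C\<close>, \<open>S\<close>) turns at the same rate up to the
  term with \<open>\<rho>'\<close>, so \<open>G\<close> cancels in \<open>u2_deriv\<close>.\<close>

definition "G t = A * a (p t) * D' - 2 * pi * \<beta> t * u2 t * t * A * a' (p t) * D'"

lemma angular_velocity:
  assumes "t \<in> {0..1}"
  shows "2 * pi * Hp t - (2 * pi * A * a' (p t) * D + 2 * pi * t * A * (a'' (p t) * - (2 * pi * (\<beta> t * u2 t))) * D)
    = 2 * pi * (G t + b t * \<Lambda> * \<rho>' (p t) * u1 t)"
  unfolding Hp_def G_def d_J[OF assms] by algebra

lemma H3_G: "t \<in> {0..1} \<Longrightarrow> H3 t = - 2 * pi * G t"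
  unfolding H3_def G_def by (simp only: d_J) algebra

lemma C_deriv:
  assumes t: "t \<in> {0..1}"
  shows "(C has_real_derivative - (2 * pi * (G t + b t * \<Lambda> * \<rho>' (p t) * u1 t) * S t)) (at t within {0..1})"
    and "(S has_real_derivative 2 * pi * (G t + b t * \<Lambda> * \<rho>' (p t) * u1 t) * C t) (at t within {0..1})"
  unfolding angular_velocity[OF t, symmetric] C_def S_def
  subgoal by (rule derivative_eq_intros wr[OF t] wi[OF t] \<phi>_deriv[OF t] refl)+ algebra
  subgoal by (rule derivative_eq_intros wr[OF t] wi[OF t] \<phi>_deriv[OF t] refl)+ algebra
  done

lemma u2_deriv:
  assumes t: "t \<in> {0..1}"
  shows "(u2 has_real_derivative \<beta> t * x3 t - 2 * pi * (b t * \<Lambda> * \<rho>' (p t) * (u1 t)\<^sup>2)) (at t within {0..1})"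
  unfolding u2_def
  by (rule derivative_eq_intros x1[OF t] x2[OF t] C_deriv[OF t] refl)+
     (use C_S_norm[OF t] H3_G[OF t] in \<open>unfold u1_def, algebra\<close>)

text \<open>On the plateau of \<open>\<rho>\<close> the equations are x_3' = - b u_2 and u_2' = b
  x_3, so (x_3, u_2) turns by the angle B(1) = pi. The constancy of J turns the change of x_3 into
  that of p.\<close>

lemma half_turn:
  assumes "\<Lambda> = 1" "\<bar>p 0\<bar> \<le> r" "\<And>y. \<bar>y\<bar> \<le> r + 4 * pi \<Longrightarrow> \<rho> y = 1 \<and> \<rho>' y = 0"
  shows "x3 1 = - x3 0" and "p 1 = p 0 - 4 * pi * x3 0"
proof -
  \<comment> \<open>x_3 changes by at most 2, hence p by at most 4 pi, and the orbit never leaves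
    the plateau.\<close>
  have \<rho>1: "\<rho> (p t) = 1 \<and> \<rho>' (p t) = 0" if t: "t \<in> {0..1}" for t
  proof (rule assms(3))
    have "\<bar>x3 t - x3 0\<bar> \<le> 2" using x3_bound[OF t] x3_bound[of 0] by simp
    then have "\<bar>2 * pi * (x3 t - x3 0)\<bar> \<le> 4 * pi" by (simp add: abs_mult)
    moreover have "p t = p 0 + 2 * pi * (x3 t - x3 0)" using J_const[OF t] by (simp add: algebra_simps)
    ultimately show "\<bar>p t\<bar> \<le> r + 4 * pi" using assms(2) by linarith
  qed
  have "((\<lambda>t. x3 t * cos (B t) + u2 t * sin (B t)) has_real_derivative 0) (at t within {0..1})"
    if t: "t \<in> {0..1}" for t
    by (rule derivative_eq_intros x3_u2[OF t] u2_deriv[OF t] b(1)[OF t] refl)+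
       (simp add: \<rho>1[OF t] \<beta>_def assms(1) algebra_simps)
  from has_real_derivative_0_const[OF this, of 1] show "x3 1 = - x3 0"
    using b(4,5) by simp
  then show "p 1 = p 0 - 4 * pi * x3 0" using J_const[of 1] by simp
qed

text \<open>The angle of w is lifted to q with q' = \<open>Hp\<close>. Because p' = - 2 pi
  \<open>\<beta>\<close> u_2, this is the derivative of t (A (a'(p) D + a(p) D')) plus b
  \<open>\<Lambda>\<close> \<open>\<rho>'\<close> u_1. So f contributes its p-derivative at the
  endpoint, and the cutoff of F at most m times the integral pi of b.\<close>

lemma lift:
  assumes m: "\<And>y. \<bar>\<rho>' y\<bar> \<le> m"
  obtains q where "continuous_on {0..1} q" "q 0 = 0"
    "\<bar>q 1 - A * (a' (p 1) * d (p 0 - 2 * pi * x3 0) + a (p 1) * d' (p 0 - 2 * pi * x3 0))\<bar> \<le> m * pi"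
    "\<And>t. t \<in> {0..1} \<Longrightarrow> Complex (wr t) (wi t) = Complex (wr 0) (wi 0) * cis (2 * pi * q t)"
proof -
  define f where "f t = b t * \<Lambda> * \<rho>' (p t) * u1 t" for t
  define F where "F y = A * (a' y * D + a y * D')" for y
  define s where "s t = integral {0..t} f" for t
  define q where "q t = t * F (p t) + s t" for t
  have cf: "continuous_on {0..1} f"
    unfolding f_def u1_def
    by (intro continuous_intros b(2) continuous_on_compose2[OF \<rho>(2)] DERIV_continuous_on[OF p]
        DERIV_continuous_on[OF x1] DERIV_continuous_on[OF x2] DERIV_continuous_on[OF C_deriv(1)]
        DERIV_continuous_on[OF C_deriv(2)]) auto
  have ds: "(s has_real_derivative f t) (at t within {0..1})" if "t \<in> {0..1}" for t
    unfolding s_def[abs_def] by (rule integral_has_real_derivative[OF cf that])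
  have dq: "(q has_real_derivative Hp t) (at t within {0..1})" if t: "t \<in> {0..1}" for t
  proof -
    have "Hp t = F (p t) + t * (A * (a'' (p t) * D + a' (p t) * D') * - (2 * pi * (\<beta> t * u2 t))) + f t"
      unfolding Hp_def F_def f_def d_J[OF t] by algebra
    moreover have "(q has_real_derivative F (p t) +
        t * (A * (a'' (p t) * D + a' (p t) * D') * - (2 * pi * (\<beta> t * u2 t))) + f t) (at t within {0..1})"
      unfolding q_def[abs_def] F_def
      by (auto intro!: derivative_eq_intros DERIV_chain2[OF a(1)] DERIV_chain2[OF a(2)] p[OF t] ds[OF t]
          simp: algebra_simps)
    ultimately show ?thesis by simp
  qed
  show thesis
  proof (rule that[of q])
    show "continuous_on {0..1} q" by (rule DERIV_continuous_on[OF dq])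
    show "q 0 = 0" by (simp add: q_def s_def)
    have m0: "m \<ge> 0" using m[of 0] by linarith
    have ib: "(b has_integral pi) {0..1}"
      using fundamental_theorem_of_calculus[of 0 1 B b] b
      by (auto simp flip: has_real_derivative_iff_has_vector_derivative)
    have "\<bar>s 1\<bar> \<le> integral {0..1} (\<lambda>t. m * b t)"
      unfolding s_def real_norm_def[symmetric]
    proof (rule integral_norm_bound_integral)
      show "f integrable_on {0..1}" by (rule integrable_continuous_real[OF cf])
      show "(\<lambda>t. m * b t) integrable_on {0..1}"
        by (intro integrable_continuous_real continuous_intros b(2))
      fix t :: real assume t: "t \<in> {0..1}"
      have "\<bar>f t\<bar> = b t * \<Lambda> * \<bar>\<rho>' (p t)\<bar> * \<bar>u1 t\<bar>"
        using b(3)[OF t] \<Lambda> by (simp add: f_def abs_mult)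
      also have "\<dots> \<le> b t * 1 * m * 1"
        using b(3)[OF t] \<Lambda> m m0 u1_bound[OF t] by (intro mult_mono) auto
      finally show "norm (f t) \<le> m * b t" by (simp add: mult.commute)
    qed
    also have "\<dots> = m * pi" using ib by (simp add: integral_unique)
    finally show "\<bar>q 1 - A * (a' (p 1) * d (p 0 - 2 * pi * x3 0) + a (p 1) * d' (p 0 - 2 * pi * x3 0))\<bar>
        \<le> m * pi"
      by (simp add: q_def F_def D_def D'_def)
    fix t :: real assume t: "t \<in> {0..1}"
    \<comment> \<open>Turning w back by the angle 2 pi q gives a vector with derivative zero, hence
      w at time 0.\<close>
    have 1: "((\<lambda>t. wr t * cos (2 * pi * q t) + wi t * sin (2 * pi * q t)) has_real_derivative 0)
        (at t within {0..1})" if t: "t \<in> {0..1}" for t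
      by (rule derivative_eq_intros wr[OF t] wi[OF t] dq[OF t] refl)+ (simp add: algebra_simps)
    have 2: "((\<lambda>t. wi t * cos (2 * pi * q t) - wr t * sin (2 * pi * q t)) has_real_derivative 0)
        (at t within {0..1})" if t: "t \<in> {0..1}" for t
      by (rule derivative_eq_intros wr[OF t] wi[OF t] dq[OF t] refl)+ (simp add: algebra_simps)
    have 3: "wr 0 = wr t * cos (2 * pi * q t) + wi t * sin (2 * pi * q t)"
        "wi 0 = wi t * cos (2 * pi * q t) - wr t * sin (2 * pi * q t)"
      using has_real_derivative_0_const[OF 1 t] has_real_derivative_0_const[OF 2 t] \<open>q 0 = 0\<close>
      by simp_all
    have "wr t * ((cos (2 * pi * q t))\<^sup>2 + (sin (2 * pi * q t))\<^sup>2) =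
        wr 0 * cos (2 * pi * q t) - wi 0 * sin (2 * pi * q t)"
      unfolding 3 by algebra
    moreover have "wi t * ((cos (2 * pi * q t))\<^sup>2 + (sin (2 * pi * q t))\<^sup>2) =
        wi 0 * cos (2 * pi * q t) + wr 0 * sin (2 * pi * q t)"
      unfolding 3 by algebra
    ultimately show "Complex (wr t) (wi t) = Complex (wr 0) (wi 0) * cis (2 * pi * q t)"
      by (simp add: complex_eq_iff)
  qed
qed

end

section \<open>The Hamiltonian in all variables and its reduction to the k-th coordinate\<close>

section \<open>The Hamiltonian\<close>

text \<open>The coefficients \<open>g\<close> depend on the point \<open>y\<close> only and not on
  the curve, so they are partial derivatives. For momenta other than p_k their existence is enough,
  since they enter only the velocities of the angles q_i with i distinct from k.\<close>

lemma prod_coordinates_deriv: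
  fixes f :: "nat \<Rightarrow> real \<Rightarrow> real"
  assumes "finite I" "\<And>i y. i \<in> I \<Longrightarrow> (f i has_real_derivative f' i y) (at y)"
  obtains g where "\<And>\<gamma> v. (\<And>i. ((\<lambda>s. \<gamma> s i) has_real_derivative v i) (at 0)) \<Longrightarrow> \<gamma> 0 = y \<Longrightarrow>
    ((\<lambda>s. \<Prod>i\<in>I. f i (\<gamma> s i)) has_real_derivative (\<Sum>i\<in>I. g i * v i)) (at 0)"
proof -
  have "\<exists>g. \<forall>\<gamma> v. (\<forall>i. ((\<lambda>s. \<gamma> s i) has_real_derivative v i) (at 0)) \<longrightarrow> \<gamma> 0 = y \<longrightarrow>
    ((\<lambda>s. \<Prod>i\<in>I. f i (\<gamma> s i)) has_real_derivative (\<Sum>i\<in>I. g i * v i)) (at 0)"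
    using assms
  proof (induction I rule: finite_induct)
    case empty
    then show ?case by auto
  next
    case (insert j I)
    then obtain g where g: "\<And>\<gamma> v. (\<forall>i. ((\<lambda>s. \<gamma> s i) has_real_derivative v i) (at 0)) \<Longrightarrow> \<gamma> 0 = y \<Longrightarrow>
      ((\<lambda>s. \<Prod>i\<in>I. f i (\<gamma> s i)) has_real_derivative (\<Sum>i\<in>I. g i * v i)) (at 0)"
      by auto
    define h where "h i = (if i = j then f' j (y j) * (\<Prod>i\<in>I. f i (y i)) else f j (y j) * g i)" for i
    have "((\<lambda>s. \<Prod>i\<in>insert j I. f i (\<gamma> s i)) has_real_derivative (\<Sum>i\<in>insert j I. h i * v i)) (at 0)"
      if v: "\<forall>i. ((\<lambda>s. \<gamma> s i) has_real_derivative v i) (at 0)" "\<gamma> 0 = y" for \<gamma> v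
    proof -
      have "((\<lambda>s. f j (\<gamma> s j)) has_real_derivative f' j (y j) * v j) (at 0)"
        using DERIV_chain2[of "f j" "f' j (y j)" "\<lambda>s. \<gamma> s j" 0] insert.prems v by auto
      from DERIV_mult[OF this g[OF v]]
      have "((\<lambda>s. f j (\<gamma> s j) * (\<Prod>i\<in>I. f i (\<gamma> s i))) has_real_derivative
          f' j (y j) * v j * (\<Prod>i\<in>I. f i (y i)) + (\<Sum>i\<in>I. g i * v i) * f j (y j)) (at 0)"
        by (simp add: v(2))
      moreover have "(\<Sum>i\<in>insert j I. h i * v i) =
          f' j (y j) * v j * (\<Prod>i\<in>I. f i (y i)) + (\<Sum>i\<in>I. g i * v i) * f j (y j)"
      proof -
        have "(\<Sum>i\<in>I. h i * v i) = (\<Sum>i\<in>I. g i * v i) * f j (y j)"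
          unfolding sum_distrib_right using insert.hyps by (intro sum.cong) (auto simp: h_def)
        then show ?thesis using insert.hyps by (simp add: h_def)
      qed
      ultimately show ?thesis using insert.hyps by simp
    qed
    then show ?case by blast
  qed
  then show thesis using that by blast
qed

text \<open>\<open>a\<close> and \<open>\<rho>\<close> are the cutoffs of f and F in p_k,
  \<open>d\<close> is the dependence of f on J, \<open>K\<close> the height of f, and
  \<open>cA\<close>, \<open>cL\<close> are inverse widths of the cutoffs in the other
  momenta.\<close>

locale model =
  fixes n k :: nat and K :: real and cA cL :: "nat \<Rightarrow> real" and a d \<rho> :: "real \<Rightarrow> real"
  assumes k: "k < n"
    and Ck: "\<And>j. Ck_on j UNIV a" "\<And>j. Ck_on j UNIV d" "\<And>j. Ck_on j UNIV \<rho>"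
begin

definition I :: "nat set" where "I = {..<n} - {k}"
definition A :: "rvec \<Rightarrow> real" where "A p = K * (\<Prod>i\<in>I. bump (cA i * p i))"
definition L :: "rvec \<Rightarrow> real" where "L p = (\<Prod>i\<in>I. bump (cL i * p i))"

text \<open>For s = 2 pi t this function and the next four become \<open>\<phi>\<close>,
  \<open>C\<close>, \<open>S\<close>, \<open>u1\<close> and \<open>u2\<close> of
  \<open>reduced_flow\<close>.\<close>

definition phase :: "real \<Rightarrow> real^3 \<Rightarrow> rvec \<Rightarrow> real" where
  "phase s x p = s * A p * deriv a (p k) * d (p k - 2 * pi * x $ 3)"

definition cosw :: "real \<Rightarrow> real^3 \<Rightarrow> rvec \<Rightarrow> cvec \<Rightarrow> real" where
  "cosw s x p w = Re (w k) * cos (phase s x p) + Im (w k) * sin (phase s x p)"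

definition sinw :: "real \<Rightarrow> real^3 \<Rightarrow> rvec \<Rightarrow> cvec \<Rightarrow> real" where
  "sinw s x p w = Im (w k) * cos (phase s x p) - Re (w k) * sin (phase s x p)"

definition u1 :: "real \<Rightarrow> real^3 \<Rightarrow> rvec \<Rightarrow> cvec \<Rightarrow> real" where
  "u1 s x p w = x $ 1 * cosw s x p w + x $ 2 * sinw s x p w"

definition u2 :: "real \<Rightarrow> real^3 \<Rightarrow> rvec \<Rightarrow> cvec \<Rightarrow> real" where
  "u2 s x p w = x $ 2 * cosw s x p w - x $ 1 * sinw s x p w"

text \<open>
  For \<open>s = 2\<pi>t\<close> and \<open>f = A a d\<close> this is \<open>f + b F \<circ> (\<phi>\<^sub>f\<^sup>t)\<^sup>-\<^sup>1\<close>, where the flow of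
  \<open>F = L \<rho> (x\<^sub>1 Re w\<^sub>k + x\<^sub>2 Im w\<^sub>k)\<close> turns the sphere about a horizontal axis that depends on \<open>w\<^sub>k\<close>.
\<close>

definition ham :: "real \<Rightarrow> real \<Rightarrow> (real^3) \<times> (rvec \<times> cvec) \<Rightarrow> real" where
  "ham b s = (\<lambda>(x, p, w). A p * a (p k) * d (p k - 2 * pi * x $ 3) + b * L p * \<rho> (p k) * u1 s x p w)"

definition grad_x :: "real \<Rightarrow> real \<Rightarrow> real^3 \<Rightarrow> rvec \<Rightarrow> cvec \<Rightarrow> real^3" where
  "grad_x b s x p w = vector [b * L p * \<rho> (p k) * cosw s x p w, b * L p * \<rho> (p k) * sinw s x p w,
     - 2 * pi * A p * a (p k) * deriv d (p k - 2 * pi * x $ 3)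
      + b * L p * \<rho> (p k) * u2 s x p w * (s * A p * deriv a (p k) * (2 * pi * deriv d (p k - 2 * pi * x $ 3)))]"

definition grad_p :: "real \<Rightarrow> real \<Rightarrow> real^3 \<Rightarrow> rvec \<Rightarrow> cvec \<Rightarrow> real" where
  "grad_p b s x p w =
     A p * (deriv a (p k) * d (p k - 2 * pi * x $ 3) + a (p k) * deriv d (p k - 2 * pi * x $ 3))
     + b * L p * deriv \<rho> (p k) * u1 s x p w
     - b * L p * \<rho> (p k) * u2 s x p w * (s * A p *
         (deriv (deriv a) (p k) * d (p k - 2 * pi * x $ 3) + deriv a (p k) * deriv d (p k - 2 * pi * x $ 3)))"

definition grad_q :: "real \<Rightarrow> real \<Rightarrow> real^3 \<Rightarrow> rvec \<Rightarrow> cvec \<Rightarrow> real" where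
  "grad_q b s x p w = 2 * pi * (b * L p * \<rho> (p k) * u2 s x p w)"

lemmas derivs = Ck_on_deriv(1)[OF Ck(1)] Ck_on_deriv(1)[OF Ck_on_deriv(2)[OF Ck(1)]]
  Ck_on_deriv(1)[OF Ck(2)] Ck_on_deriv(1)[OF Ck(3)]

lemma finite_I: "finite I" by (simp add: I_def)

text \<open>A tangent velocity is orthogonal to w_i in the plane, so dq_i alone determines
  it.\<close>

lemma dq_velocity:
  assumes "w \<in> torus n" "tangent_vector n x w \<xi> v b" "i < n"
  shows "Re (b i) = - (2 * pi * dq i w b * Im (w i))" "Im (b i) = 2 * pi * dq i w b * Re (w i)"
proof -
  have w: "(Re (w i))\<^sup>2 + (Im (w i))\<^sup>2 = 1"
    using assms by (metis (mono_tags, lifting) cmod_power2 mem_Collect_eq power_one torus_def)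
  have t: "Re (w i) * Re (b i) + Im (w i) * Im (b i) = 0"
    using assms by (simp add: tangent_vector_def)
  have q: "2 * pi * dq i w b = Re (w i) * Im (b i) - Im (w i) * Re (b i)"
    by (simp add: dq_def)
  show "Re (b i) = - (2 * pi * dq i w b * Im (w i))" "Im (b i) = 2 * pi * dq i w b * Re (w i)"
    unfolding q using w t by algebra+
qed

text \<open>Among the angles only q_k enters \<open>ham\<close>. The derivatives by x, p_k and q_k
  are explicit; those by the other momenta come from the cutoffs \<open>A\<close> and
  \<open>L\<close> and stay abstract in \<open>hp\<close>.\<close>

lemma ham_gradient:
  assumes x: "x \<in> sphere2" and w: "w \<in> torus n" and P: "P \<subseteq> euclid n"
  obtains hp where "hp k = grad_p b s x p w"
    and "\<And>\<gamma> \<xi> v c. curve_through (sphere2 \<times> (P \<times> torus n)) (x, p, w) (\<xi>, v, c) \<gamma> \<Longrightarrow>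
      ((\<lambda>t. ham b s (\<gamma> t)) has_real_derivative grad_x b s x p w \<bullet> \<xi> +
        (\<Sum>i<n. hp i * apply_bcontfun v i + (if i = k then grad_q b s x p w else 0) * dq i w c)) (at 0)"
proof -
  let ?p = "\<lambda>\<gamma> t i. apply_bcontfun (fst (snd (\<gamma> t :: (real^3) \<times> (rvec \<times> cvec)))) i"
  obtain gA where gA: "\<And>\<gamma> v. (\<And>i. ((\<lambda>s. \<gamma> s i) has_real_derivative v i) (at 0)) \<Longrightarrow> \<gamma> 0 = apply_bcontfun p \<Longrightarrow>
      ((\<lambda>s. \<Prod>i\<in>I. bump (cA i * \<gamma> s i)) has_real_derivative (\<Sum>i\<in>I. gA i * v i)) (at 0)"
    using prod_coordinates_deriv[of I "\<lambda>i y. bump (cA i * y)" _ "apply_bcontfun p", OF finite_I scaled_bump_deriv] by blast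
  obtain gL where gL: "\<And>\<gamma> v. (\<And>i. ((\<lambda>s. \<gamma> s i) has_real_derivative v i) (at 0)) \<Longrightarrow> \<gamma> 0 = apply_bcontfun p \<Longrightarrow>
      ((\<lambda>s. \<Prod>i\<in>I. bump (cL i * \<gamma> s i)) has_real_derivative (\<Sum>i\<in>I. gL i * v i)) (at 0)"
    using prod_coordinates_deriv[of I "\<lambda>i y. bump (cL i * y)" _ "apply_bcontfun p", OF finite_I scaled_bump_deriv] by blast
  let ?J = "p k - 2 * pi * x $ 3"
  \<comment> \<open>The derivatives of \<open>ham\<close> by the products of bumps in
    \<open>A\<close> and in \<open>L\<close>. The former acts twice: through f and, via
    \<open>phase\<close>, through \<open>u1\<close>.\<close>
  define cA' where "cA' = K * (a (p k) * d ?J - b * L p * \<rho> (p k) * u2 s x p w * (s * deriv a (p k) * d ?J))"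
  define cL' where "cL' = b * \<rho> (p k) * u1 s x p w"
  define hp where "hp i = (if i = k then grad_p b s x p w else cA' * gA i + cL' * gL i)" for i
  show thesis
  proof (rule that[of hp])
    show "hp k = grad_p b s x p w" by (simp add: hp_def)
    fix \<gamma> \<xi> v c
    assume \<gamma>: "curve_through (sphere2 \<times> (P \<times> torus n)) (x, p, w) (\<xi>, v, c) \<gamma>"
    then have d0: "(\<gamma> has_vector_derivative (\<xi>, v, c)) (at 0)" and 0: "\<gamma> 0 = (x, p, w)"
      by (auto simp: curve_through_def)
    note dc = curve_components[OF d0]
    note q = dq_velocity[OF w curve_through_tangent_vector[OF \<gamma> P] k]
    let ?x = "\<lambda>t. fst (\<gamma> t)" and ?P = "\<lambda>t. fst (snd (\<gamma> t))" and ?w = "\<lambda>t. snd (snd (\<gamma> t))"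
    define vA where "vA = (\<Sum>i\<in>I. gA i * v i)"
    define vL where "vL = (\<Sum>i\<in>I. gL i * v i)"
    define q where "q = dq k w c"
    define v3 where "v3 = apply_bcontfun v k - 2 * pi * \<xi> $ 3"
    have dA: "((\<lambda>t. A (?P t)) has_real_derivative K * vA) (at 0)"
      unfolding A_def vA_def by (rule DERIV_cmult[OF gA]) (use dc(3) 0 in auto)
    have dL: "((\<lambda>t. L (?P t)) has_real_derivative vL) (at 0)"
      unfolding L_def vL_def by (rule gL) (use dc(3) 0 in auto)
    have J: "((\<lambda>t. ?P t k - 2 * pi * ?x t $ 3) has_real_derivative v3) (at 0)"
      unfolding v3_def by (rule derivative_eq_intros dc refl)+ simp
    have dd: "((\<lambda>t. d (?P t k - 2 * pi * ?x t $ 3)) has_real_derivative deriv d ?J * v3) (at 0)"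
      using DERIV_chain2[OF _ J, of d] derivs(3) by (simp add: 0)
    have da: "((\<lambda>t. a (?P t k)) has_real_derivative deriv a (p k) * v k) (at 0)"
      using DERIV_chain2[OF _ dc(3), of a _ k] derivs(1) by (simp add: 0)
    have da': "((\<lambda>t. deriv a (?P t k)) has_real_derivative deriv (deriv a) (p k) * v k) (at 0)"
      using DERIV_chain2[OF _ dc(3), of "deriv a" _ k] derivs(2) by (simp add: 0)
    have d\<rho>: "((\<lambda>t. \<rho> (?P t k)) has_real_derivative deriv \<rho> (p k) * v k) (at 0)"
      using DERIV_chain2[OF _ dc(3), of \<rho> _ k] derivs(4) by (simp add: 0)
    define \<phi>' where "\<phi>' = s * (K * vA * deriv a (p k) * d ?J + A p * (deriv (deriv a) (p k) * v k) * d ?J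
        + A p * deriv a (p k) * (deriv d ?J * v3))"
    have d\<phi>: "((\<lambda>t. phase s (?x t) (?P t)) has_real_derivative \<phi>') (at 0)"
      unfolding phase_def \<phi>'_def
      by (rule derivative_eq_intros dA da' dd refl)+ (simp add: 0 algebra_simps)
    have dC: "((\<lambda>t. cosw s (?x t) (?P t) (?w t)) has_real_derivative (\<phi>' - 2 * pi * q) * sinw s x p w) (at 0)"
      unfolding cosw_def sinw_def
      by (rule derivative_eq_intros dc d\<phi> refl)+ (simp add: 0 q q_def[symmetric] algebra_simps)
    have dS: "((\<lambda>t. sinw s (?x t) (?P t) (?w t)) has_real_derivative (2 * pi * q - \<phi>') * cosw s x p w) (at 0)"
      unfolding cosw_def sinw_def
      by (rule derivative_eq_intros dc d\<phi> refl)+ (simp add: 0 q q_def[symmetric] algebra_simps)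
    have du: "((\<lambda>t. u1 s (?x t) (?P t) (?w t)) has_real_derivative
        \<xi> $ 1 * cosw s x p w + \<xi> $ 2 * sinw s x p w + (2 * pi * q - \<phi>') * u2 s x p w) (at 0)"
      unfolding u1_def u2_def
      by (rule derivative_eq_intros dc dC dS refl)+ (simp add: 0 algebra_simps)
    have "((\<lambda>t. ham b s (\<gamma> t)) has_real_derivative
        K * vA * a (p k) * d ?J + A p * (deriv a (p k) * v k) * d ?J + A p * a (p k) * (deriv d ?J * v3)
        + b * (vL * \<rho> (p k) * u1 s x p w + L p * (deriv \<rho> (p k) * v k) * u1 s x p w
          + L p * \<rho> (p k) * (\<xi> $ 1 * cosw s x p w + \<xi> $ 2 * sinw s x p w + (2 * pi * q - \<phi>') * u2 s x p w))) (at 0)"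
      unfolding ham_def split_beta
      by (rule derivative_eq_intros dA dL dd da d\<rho> du refl)+ (simp add: 0 algebra_simps)
    moreover have "(\<Sum>i<n. hp i * v i + (if i = k then grad_q b s x p w else 0) * dq i w c) =
        grad_p b s x p w * v k + grad_q b s x p w * q + (cA' * vA + cL' * vL)"
    proof -
      let ?F = "\<lambda>i. hp i * v i + (if i = k then grad_q b s x p w else 0) * dq i w c"
      have "sum ?F {..<n} = ?F k + sum ?F I"
        using k by (simp add: I_def sum.remove[of "{..<n}" k])
      moreover have "sum ?F I = (\<Sum>i\<in>I. cA' * (gA i * v i) + cL' * (gL i * v i))"
        by (intro sum.cong) (auto simp: I_def hp_def algebra_simps)
      ultimately have "sum ?F {..<n} = grad_p b s x p w * v k + grad_q b s x p w * q
          + (\<Sum>i\<in>I. cA' * (gA i * v i) + cL' * (gL i * v i))"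
        by (simp add: q_def hp_def)
      then show ?thesis by (simp add: sum.distrib sum_distrib_left vA_def vL_def)
    qed
    moreover have "grad_x b s x p w \<bullet> \<xi> + (grad_p b s x p w * v k + grad_q b s x p w * q + (cA' * vA + cL' * vL)) =
        K * vA * a (p k) * d ?J + A p * (deriv a (p k) * v k) * d ?J + A p * a (p k) * (deriv d ?J * v3)
        + b * (vL * \<rho> (p k) * u1 s x p w + L p * (deriv \<rho> (p k) * v k) * u1 s x p w
          + L p * \<rho> (p k) * (\<xi> $ 1 * cosw s x p w + \<xi> $ 2 * sinw s x p w + (2 * pi * q - \<phi>') * u2 s x p w))"
      by (simp add: grad_x_def grad_p_def grad_q_def cA'_def cL'_def \<phi>'_def v3_def inner_vec_def sum_3
          vector_3 algebra_simps)
    ultimately show "((\<lambda>t. ham b s (\<gamma> t)) has_real_derivative grad_x b s x p w \<bullet> \<xi> +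
        (\<Sum>i<n. hp i * apply_bcontfun v i + (if i = k then grad_q b s x p w else 0) * dq i w c)) (at 0)"
      by simp
  qed
qed

lemma hamiltonian_vector_ham:
  assumes "x \<in> sphere2" "w \<in> torus n" "P \<subseteq> euclid n"
    and "\<And>v. v \<in> euclid n \<Longrightarrow> \<exists>\<eta>>0. \<forall>s. \<bar>s\<bar> \<le> \<eta> \<longrightarrow> p + s *\<^sub>R v \<in> P"
  obtains hp where "hp k = grad_p b s x p w"
    "\<And>\<xi> v c. hamiltonian_vector (sphere2 \<times> (P \<times> torus n)) (product_form area_form (omega0 n)) (ham b s) (x, p, w) (\<xi>, v, c)
      \<longleftrightarrow> tangent_vector n x w \<xi> v c \<and> \<xi> = cross3 x (grad_x b s x p w) \<and>
        (\<forall>i<n. v i = - (if i = k then grad_q b s x p w else 0) \<and> dq i w c = hp i)"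
proof -
  obtain hp where "hp k = grad_p b s x p w" and
    "\<And>\<gamma> \<xi> v c. curve_through (sphere2 \<times> (P \<times> torus n)) (x, p, w) (\<xi>, v, c) \<gamma> \<Longrightarrow>
      ((\<lambda>t. ham b s (\<gamma> t)) has_real_derivative grad_x b s x p w \<bullet> \<xi> +
        (\<Sum>i<n. hp i * apply_bcontfun v i + (if i = k then grad_q b s x p w else 0) * dq i w c)) (at 0)"
    using ham_gradient[OF assms(1-3)] by blast
  with hamiltonian_vector_iff[OF assms] show thesis
    by (intro that[of hp]) auto
qed

lemma smooth_ham:
  fixes b s :: "real \<Rightarrow> real"
  assumes "\<And>j. Ck_on j UNIV b" "\<And>j. Ck_on j UNIV s"
  shows "Ck_on j UNIV (\<lambda>(t, z). ham (b t) (s t) z)"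
proof -
  have lin: "Ck_on j UNIV (\<lambda>y::real \<times> (real^3) \<times> (rvec \<times> cvec). fst (snd y) $ m)"
    "Ck_on j UNIV (\<lambda>y::real \<times> (real^3) \<times> (rvec \<times> cvec). apply_bcontfun (fst (snd (snd y))) i)"
    "Ck_on j UNIV (\<lambda>y::real \<times> (real^3) \<times> (rvec \<times> cvec). Re (apply_bcontfun (snd (snd (snd y))) i))"
    "Ck_on j UNIV (\<lambda>y::real \<times> (real^3) \<times> (rvec \<times> cvec). Im (apply_bcontfun (snd (snd (snd y))) i))" for j m i
    by (intro Ck_on_bounded_linear[OF bounded_linear_vec_nth] Ck_on_bounded_linear[OF bounded_linear_fst]
        Ck_on_bounded_linear[OF bounded_linear_snd] Ck_on_bounded_linear[OF bounded_linear_apply_bcontfun]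
        Ck_on_bounded_linear[OF bounded_linear_Re] Ck_on_bounded_linear[OF bounded_linear_Im] Ck_on_ident)+
  have t: "Ck_on j UNIV (\<lambda>y::real \<times> (real^3) \<times> (rvec \<times> cvec). b (fst y))"
    "Ck_on j UNIV (\<lambda>y::real \<times> (real^3) \<times> (rvec \<times> cvec). s (fst y))" for j
    by (intro Ck_on_compose_real[OF assms(1)] Ck_on_compose_real[OF assms(2)]
        Ck_on_bounded_linear[OF bounded_linear_fst] Ck_on_ident)+
  show ?thesis
    unfolding ham_def split_beta u1_def cosw_def sinw_def phase_def A_def L_def
    by (intro Ck_on_intros lin t Ck_on_compose_real[OF Ck(1)] Ck_on_compose_real[OF Ck(2)]
        Ck_on_compose_real[OF Ck(3)] Ck_on_compose_real[OF Ck_on_deriv(2)[OF Ck(1)]]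
        Ck_on_compose_real[OF Ck_on_bump])
qed

text \<open>\<open>ham\<close> is independent of q_i for i distinct from k, so these p_i are
  constant. Hence \<open>A\<close> and \<open>L\<close> are constant along the orbit, and the
  equations for x, p_k and w_k close up.\<close>

lemma reduced_flow:
  assumes P: "P \<subseteq> euclid n"
      "\<And>p v. p \<in> P \<Longrightarrow> v \<in> euclid n \<Longrightarrow> \<exists>\<eta>>0. \<forall>s. \<bar>s\<bar> \<le> \<eta> \<longrightarrow> p + s *\<^sub>R v \<in> P"
    and b: "\<And>t. t \<in> {0..1} \<Longrightarrow> (B has_real_derivative b t) (at t within {0..1})"
      "continuous_on {0..1} b" "\<And>t. t \<in> {0..1} \<Longrightarrow> b t \<ge> 0"
      "B 0 = 0" "B 1 = pi"
    and z: "\<And>t. t \<in> {0..1} \<Longrightarrow> z t \<in> sphere2 \<times> (P \<times> torus n)"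
      "\<And>t. t \<in> {0..1} \<Longrightarrow> \<exists>X. hamiltonian_vector (sphere2 \<times> (P \<times> torus n))
        (product_form area_form (omega0 n)) (ham (b t) (2 * pi * t)) (z t) X \<and> (z has_vector_derivative X) (at t)"
  shows "reduced_flow (A (fst (snd (z 0)))) (L (fst (snd (z 0)))) a (deriv a) (deriv (deriv a)) d (deriv d)
      \<rho> (deriv \<rho>) b B (\<lambda>t. fst (z t) $ 1) (\<lambda>t. fst (z t) $ 2) (\<lambda>t. fst (z t) $ 3)
      (\<lambda>t. fst (snd (z t)) k) (\<lambda>t. Re (snd (snd (z t)) k)) (\<lambda>t. Im (snd (snd (z t)) k))"
proof -
  define x p w where "x t = fst (z t)" and "p t = fst (snd (z t))" and "w t = snd (snd (z t))" for t
  have zt: "z t = (x t, p t, w t)" for t by (simp add: x_def p_def w_def)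
  have dx: "((\<lambda>t. x t $ j) has_real_derivative cross3 (x t) (grad_x (b t) (2 * pi * t) (x t) (p t) (w t)) $ j)
        (at t within {0..1})"
      and dp: "i < n \<Longrightarrow> ((\<lambda>t. apply_bcontfun (p t) i) has_real_derivative
        - (if i = k then grad_q (b t) (2 * pi * t) (x t) (p t) (w t) else 0)) (at t within {0..1})"
      and dw: "((\<lambda>t. Re (w t k)) has_real_derivative
        - (2 * pi * grad_p (b t) (2 * pi * t) (x t) (p t) (w t) * Im (w t k))) (at t within {0..1})"
        "((\<lambda>t. Im (w t k)) has_real_derivative
        2 * pi * grad_p (b t) (2 * pi * t) (x t) (p t) (w t) * Re (w t k)) (at t within {0..1})"
      and norms: "(x t $ 1)\<^sup>2 + (x t $ 2)\<^sup>2 + (x t $ 3)\<^sup>2 = 1"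
        "(Re (w t k))\<^sup>2 + (Im (w t k))\<^sup>2 = 1"
    if t: "t \<in> {0..1}" for t i j
  proof -
    have zN: "x t \<in> sphere2" "p t \<in> P" "w t \<in> torus n" using z(1)[OF t] by (auto simp: zt)
    obtain \<xi> v c where X: "hamiltonian_vector (sphere2 \<times> (P \<times> torus n))
        (product_form area_form (omega0 n)) (ham (b t) (2 * pi * t)) (x t, p t, w t) (\<xi>, v, c)"
      "(z has_vector_derivative (\<xi>, v, c)) (at t)"
      using z(2)[OF t] by (metis prod.exhaust zt)
    obtain hp where hp: "hp k = grad_p (b t) (2 * pi * t) (x t) (p t) (w t)"
      "\<And>\<xi> v c. hamiltonian_vector (sphere2 \<times> (P \<times> torus n)) (product_form area_form (omega0 n))
        (ham (b t) (2 * pi * t)) (x t, p t, w t) (\<xi>, v, c)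
      \<longleftrightarrow> tangent_vector n (x t) (w t) \<xi> v c \<and> \<xi> = cross3 (x t) (grad_x (b t) (2 * pi * t) (x t) (p t) (w t)) \<and>
        (\<forall>i<n. v i = - (if i = k then grad_q (b t) (2 * pi * t) (x t) (p t) (w t) else 0) \<and> dq i (w t) c = hp i)"
      using hamiltonian_vector_ham[OF zN(1,3) P(1) P(2)[OF zN(2)]] by blast
    have V: "tangent_vector n (x t) (w t) \<xi> v c"
      "\<xi> = cross3 (x t) (grad_x (b t) (2 * pi * t) (x t) (p t) (w t))"
      "\<And>i. i < n \<Longrightarrow> v i = - (if i = k then grad_q (b t) (2 * pi * t) (x t) (p t) (w t) else 0)"
      "dq k (w t) c = grad_p (b t) (2 * pi * t) (x t) (p t) (w t)"
      using X(1)[unfolded hp(2)] k hp(1) by metis+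
    note q = dq_velocity[OF zN(3) V(1) k, unfolded V(4)]
    note c = curve_components[OF X(2), folded x_def p_def w_def]
    note within = has_field_derivative_at_within[of _ _ t "{0..1}"]
    show "((\<lambda>t. x t $ j) has_real_derivative cross3 (x t) (grad_x (b t) (2 * pi * t) (x t) (p t) (w t)) $ j)
        (at t within {0..1})"
      by (rule within[OF c(2)[of j, unfolded V(2)]])
    show "((\<lambda>t. apply_bcontfun (p t) i) has_real_derivative
        - (if i = k then grad_q (b t) (2 * pi * t) (x t) (p t) (w t) else 0)) (at t within {0..1})" if "i < n"
      by (rule within[OF DERIV_cong[OF c(3) V(3)[OF that]]])
    show "((\<lambda>t. Re (w t k)) has_real_derivative
        - (2 * pi * grad_p (b t) (2 * pi * t) (x t) (p t) (w t) * Im (w t k))) (at t within {0..1})"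
      by (rule within[OF c(5)[of k, unfolded q(1)]])
    show "((\<lambda>t. Im (w t k)) has_real_derivative
        2 * pi * grad_p (b t) (2 * pi * t) (x t) (p t) (w t) * Re (w t k)) (at t within {0..1})"
      by (rule within[OF c(6)[of k, unfolded q(2)]])
    show "(x t $ 1)\<^sup>2 + (x t $ 2)\<^sup>2 + (x t $ 3)\<^sup>2 = 1"
      using zN(1) by (simp add: sphere2_def)
    show "(Re (w t k))\<^sup>2 + (Im (w t k))\<^sup>2 = 1"
      using zN(3) k by (simp add: torus_def flip: cmod_power2)
  qed
  have p_const: "p t i = p 0 i" if "t \<in> {0..1}" "i \<in> I" for t i
    by (rule has_real_derivative_0_const[OF _ that(1)])
       (use dp[of _ i] that(2) in \<open>auto simp: I_def\<close>)
  have AL: "A (p t) = A (p 0)" "L (p t) = L (p 0)" if "t \<in> {0..1}" for t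
    unfolding A_def L_def using p_const[OF that] by (simp_all cong: prod.cong)
  have L01: "0 \<le> L (p 0)" "L (p 0) \<le> 1"
    by (auto simp: L_def bump_nonneg bump_le_1 intro!: prod_nonneg prod_le_1)
  note defs = grad_x_def grad_p_def grad_q_def u1_def u2_def cosw_def sinw_def phase_def
    cross_components vector_3
  show ?thesis
    unfolding x_def[symmetric] p_def[symmetric] w_def[symmetric]
  proof (unfold_locales, goal_cases)
    \<comment> \<open>Cases 13 to 18 are the differential equations for x_1, x_2, x_3, p, Re w and
      Im w.\<close>
    case (13 t)
    then show ?case by (rule DERIV_cong[OF dx]) (simp add: defs AL[OF 13] mult_ac)
  next
    case (14 t)
    then show ?case by (rule DERIV_cong[OF dx]) (simp add: defs AL[OF 14] mult_ac)
  next
    case (15 t)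
    then show ?case by (rule DERIV_cong[OF dx]) (simp add: defs AL[OF 15] mult_ac)
  next
    case (16 t)
    then show ?case by (rule DERIV_cong[OF dp[OF _ k]]) (simp add: defs AL[OF 16])
  next
    case (17 t)
    then show ?case by (rule DERIV_cong[OF dw(1)]) (simp add: defs AL[OF 17])
  next
    case (18 t)
    then show ?case by (rule DERIV_cong[OF dw(2)]) (simp add: defs AL[OF 18])
  qed (use b derivs L01 norms Ck_on_deriv(2)[OF Ck(3), of 0] in auto)
qed

end

text \<open>A smooth rise from 0 to pi: the argument of \<open>bump\<close> runs from 1/2 to 5/2,
  and the descent of \<open>bump\<close> on [1, 2] takes place for t in [1/4, 3/4].\<close>

definition turn_angle :: "real \<Rightarrow> real" where "turn_angle t = pi * (1 - bump (1 / 2 + 2 * t))"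
definition turn_speed :: "real \<Rightarrow> real" where "turn_speed t = - 2 * pi * deriv bump (1 / 2 + 2 * t)"

lemma turn_angle_deriv: "(turn_angle has_real_derivative turn_speed t) (at t)"
  unfolding turn_angle_def[abs_def] turn_speed_def
  by (auto intro!: derivative_eq_intros DERIV_chain2[OF Ck_on_deriv(1)[OF Ck_on_bump]])

lemma turn_angle_0: "turn_angle 0 = 0" and turn_angle_1: "turn_angle 1 = pi"
  by (simp_all add: turn_angle_def bump_eq_1 bump_eq_0)

lemma turn_speed_nonneg: "t \<ge> 0 \<Longrightarrow> turn_speed t \<ge> 0"
  using bump_deriv_nonpos[of "1 / 2 + 2 * t"] by (simp add: turn_speed_def mult_nonneg_nonpos)

lemma turn_speed_eq_0: "0 \<le> t \<Longrightarrow> t < 1/4 \<or> 3/4 < t \<Longrightarrow> turn_speed t = 0"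
  using bump_deriv_eq_0[of "1 / 2 + 2 * t"] by (auto simp: turn_speed_def)

lemma Ck_on_turn_speed: "Ck_on j UNIV turn_speed"
  unfolding turn_speed_def[abs_def]
  by (intro Ck_on_intros Ck_on_compose_real[OF Ck_on_deriv(2)[OF Ck_on_bump]])

section \<open>Absence of winding in q_k for closed orbits\<close>

context model
begin

lemma ham_0: "ham 0 s = ham 0 0"
  by (simp add: ham_def)

text \<open>The k-th coordinate maps the torus into C - {0}, where winding numbers are homotopy
  invariant. The standard loop has winding number e_k, and a loop whose angle lifts to q has q(1) -
  q(0).\<close>

lemma winding:
  fixes w :: "real \<Rightarrow> cvec"
  assumes q: "continuous_on {0..1} q" "q 0 = 0"
    and w: "\<And>t. t \<in> {0..1} \<Longrightarrow> w t k = w 0 k * cis (2 * pi * q t)"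
    and hom: "homotopic_loops (torus n) w (torus_loop n e)"
  shows "q 1 = e k"
proof -
  have 1: "cmod (w t k) = 1" if "t \<in> {0..1}" for t
    using homotopic_loops_imp_subset[OF hom] that k
    by (auto simp: path_image_def image_subset_iff torus_def)
  have "homotopic_loops (- {0}) ((\<lambda>v. apply_bcontfun v k) \<circ> w) ((\<lambda>v. apply_bcontfun v k) \<circ> torus_loop n e)"
  proof (rule homotopic_loops_continuous_image[OF hom])
    show "continuous_on (torus n) (\<lambda>v. apply_bcontfun v k)"
      by (intro bounded_linear.continuous_on[OF bounded_linear_apply_bcontfun] continuous_intros)
    show "(\<lambda>v. apply_bcontfun v k) \<in> torus n \<rightarrow> - {0}"
      using k by (force simp: torus_def)
  qed
  then have "winding_number ((\<lambda>v. apply_bcontfun v k) \<circ> w) 0 =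
      winding_number ((\<lambda>v. apply_bcontfun v k) \<circ> torus_loop n e) 0"
    by (rule winding_number_homotopic_loops)
  also have "(\<lambda>v. apply_bcontfun v k) \<circ> torus_loop n e = exp \<circ> (\<lambda>t. \<i> * of_real (2 * pi * of_int (e k) * t))"
    using k by (simp add: fun_eq_iff apply_torus_loop cis_conv_exp)
  also have "winding_number \<dots> 0 = e k"
    by (subst winding_number_compose_exp)
       (auto simp: path_def pathfinish_def pathstart_def intro!: continuous_intros)
  also have "winding_number ((\<lambda>v. apply_bcontfun v k) \<circ> w) 0 =
      winding_number (exp \<circ> (\<lambda>t. Ln (w 0 k) + \<i> * of_real (2 * pi * q t))) 0"
  proof (rule winding_number_cong)
    fix t :: real assume "0 \<le> t" "t \<le> 1"
    moreover have "w 0 k \<noteq> 0" using 1[of 0] by auto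
    ultimately show "((\<lambda>v. apply_bcontfun v k) \<circ> w) t = (exp \<circ> (\<lambda>t. Ln (w 0 k) + \<i> * of_real (2 * pi * q t))) t"
      using w[of t] by (simp add: exp_add cis_conv_exp)
  qed
  also have "\<dots> = q 1"
    using q(2) by (subst winding_number_compose_exp)
       (auto simp: path_def pathfinish_def pathstart_def intro!: continuous_intros q(1))
  finally show ?thesis
    by (metis of_real_eq_iff of_real_of_int_eq)
qed

text \<open>Once the contribution of f is zero, \<open>lift\<close> bounds the integer e_k by pi/4
  in absolute value.\<close>

lemma no_winding_orbit:
  assumes P: "P \<subseteq> euclid n"
      "\<And>p v. p \<in> P \<Longrightarrow> v \<in> euclid n \<Longrightarrow> \<exists>\<eta>>0. \<forall>s. \<bar>s\<bar> \<le> \<eta> \<longrightarrow> p + s *\<^sub>R v \<in> P"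
    and a: "\<And>y. \<bar>y\<bar> > \<delta> \<Longrightarrow> a y = 0 \<and> deriv a y = 0"
    and d: "\<And>y. \<bar>y\<bar> \<le> \<delta> \<Longrightarrow> d y = 0 \<and> deriv d y = 0"
    and \<rho>: "\<And>y. \<bar>y\<bar> \<le> \<delta> + 4 * pi \<Longrightarrow> \<rho> y = 1 \<and> deriv \<rho> y = 0" "\<And>y. \<bar>deriv \<rho> y\<bar> \<le> 1 / 4"
    and AL: "\<And>p. A p \<noteq> 0 \<Longrightarrow> L p = 1"
    and z: "integral_curve (sphere2 \<times> (P \<times> torus n)) (product_form area_form (omega0 n))
        (\<lambda>t. ham (turn_speed (frac t)) (2 * pi * frac t)) z" "z 1 = z 0"
    and hom: "homotopic_loops (torus n) (snd \<circ> snd \<circ> z) (torus_loop n e)"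
  shows "e k = 0"
proof -
  \<comment> \<open>Only t = 1 differs, where \<open>frac\<close> jumps to 0; there
    \<open>turn_speed\<close> is 0 on both sides, and \<open>ham 0 s\<close> does not depend on
    s.\<close>
  have eq: "ham (turn_speed (frac t)) (2 * pi * frac t) = ham (turn_speed t) (2 * pi * t)" if "t \<in> {0..1}" for t
  proof (cases "t = 1")
    case True
    have "turn_speed 0 = 0" "turn_speed 1 = 0" by (rule turn_speed_eq_0; simp)+
    then show ?thesis using True by (simp add: ham_0[of "2 * pi"])
  next
    case False
    then show ?thesis using that by simp
  qed
  let ?A = "A (fst (snd (z 0)))" and ?L = "L (fst (snd (z 0)))"
  let ?p = "\<lambda>t. apply_bcontfun (fst (snd (z t))) k" and ?x3 = "\<lambda>t. fst (z t) $ 3"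
  have rf: "reduced_flow ?A ?L a (deriv a) (deriv (deriv a)) d (deriv d) \<rho> (deriv \<rho>) turn_speed turn_angle
      (\<lambda>t. fst (z t) $ 1) (\<lambda>t. fst (z t) $ 2) ?x3 ?p
      (\<lambda>t. Re (apply_bcontfun (snd (snd (z t))) k)) (\<lambda>t. Im (apply_bcontfun (snd (snd (z t))) k))"
  proof (rule reduced_flow[OF P])
    show "continuous_on {0..1} turn_speed"
      using Ck_on_turn_speed[of 0] by (auto intro: continuous_on_subset)
    fix t :: real assume t: "t \<in> {0..1}"
    show "z t \<in> sphere2 \<times> P \<times> torus n" using z(1) by (simp add: integral_curve_def)
    show "\<exists>X. hamiltonian_vector (sphere2 \<times> P \<times> torus n) (product_form area_form (omega0 n))
        (ham (turn_speed t) (2 * pi * t)) (z t) X \<and> (z has_vector_derivative X) (at t)"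
      using z(1) unfolding integral_curve_def eq[OF t, symmetric] by blast
  qed (auto intro: has_field_derivative_at_within turn_angle_deriv turn_speed_nonneg
      simp: turn_angle_0 turn_angle_1)
  let ?J = "?p 0 - 2 * pi * ?x3 0"
  \<comment> \<open>Three cases: A = 0; or |p_k| > \<open>\<delta>\<close> at both ends, where
    \<open>a\<close> vanishes; or the half turn and closedness force x_3 = 0, so that J = p_k lies
    where \<open>d\<close> and its derivative vanish. In the last case \<open>AL\<close> supplies
    the amplitude 1 that \<open>half_turn\<close> asks for.\<close>
  have vanish: "?A * (deriv a (?p 1) * d ?J + a (?p 1) * deriv d ?J) = 0"
  proof (cases "?A = 0 \<or> \<bar>?p 0\<bar> > \<delta>")
    case True
    then show ?thesis using a[of "?p 0"] by (auto simp: z(2))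
  next
    case False
    then have "?x3 1 = - ?x3 0"
      using reduced_flow.half_turn(1)[OF rf, of \<delta>] AL \<rho>(1) by auto
    then have "?x3 0 = 0" using z(2) by simp
    then have "d ?J = 0" "deriv d ?J = 0" using d[of "?p 0"] False by auto
    then show ?thesis by simp
  qed
  obtain q where q: "continuous_on {0..1} q" "q 0 = 0"
    "\<bar>q 1 - ?A * (deriv a (?p 1) * d ?J + a (?p 1) * deriv d ?J)\<bar> \<le> 1 / 4 * pi"
    "\<And>t. t \<in> {0..1} \<Longrightarrow> apply_bcontfun (snd (snd (z t))) k = apply_bcontfun (snd (snd (z 0))) k * cis (2 * pi * q t)"
    using reduced_flow.lift[OF rf \<rho>(2)] unfolding complex_surj by blast
  have "q 1 = e k"
    by (rule winding[OF q(1,2) _ hom]) (unfold o_def, rule q(4))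
  moreover have "\<bar>q 1\<bar> < 1" using q(3) pi_less_4 unfolding vanish by simp
  ultimately show ?thesis by linarith
qed

text \<open>\<open>turn_speed\<close> vanishes near 0 and 1, so the jumps of \<open>frac\<close> do no harm.\<close>

lemma smooth_ham_frac: "smooth_on (UNIV \<times> N) (\<lambda>(t, z). ham (turn_speed (frac t)) (2 * pi * frac t) z)"
  unfolding smooth_on_def
proof (intro ballI)
  fix y :: "real \<times> (real^3) \<times> (rvec \<times> cvec)" assume "y \<in> UNIV \<times> N"
  obtain t z where y: "y = (t, z)" by (cases y)
  show "\<exists>U g. open U \<and> y \<in> U \<and> (\<forall>j. Ck_on j U g) \<and>
      (\<forall>y\<in>U \<inter> UNIV \<times> N. g y = (case y of (t, z) \<Rightarrow> ham (turn_speed (frac t)) (2 * pi * frac t) z))"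
  proof (cases "t \<in> \<int>")
    case True
    then obtain m where m: "t = of_int m" by (auto elim: Ints_cases)
    let ?U = "{t - 1/8<..<t + 1/8} \<times> (UNIV :: ((real^3) \<times> (rvec \<times> cvec)) set)"
    have "turn_speed (frac r) = 0" if "r \<in> {t - 1/8<..<t + 1/8}" for r
    proof (cases "r \<ge> t")
      case True
      then have "frac r = r - t" using that m by (simp add: frac_unique_iff)
      then show ?thesis using that True by (intro turn_speed_eq_0) auto
    next
      case False
      then have "frac r = r - t + 1" using that m by (simp add: frac_unique_iff)
      then show ?thesis using that by (intro turn_speed_eq_0) auto
    qed
    moreover have "Ck_on j ?U (\<lambda>(t, z). ham 0 0 z)" for j
      by (rule Ck_on_UNIV_subset) (intro smooth_ham Ck_on_const)
    ultimately show ?thesis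
      by (intro exI[of _ ?U] exI[of _ "\<lambda>(t, z). ham 0 0 z"])
         (auto simp: y open_Times ham_0[of "2 * pi * frac _"])
  next
    case False
    define m where "m = real_of_int \<lfloor>t\<rfloor>"
    let ?U = "{m<..<m + 1} \<times> (UNIV :: ((real^3) \<times> (rvec \<times> cvec)) set)"
    have "m < t" "t < m + 1"
      using False unfolding m_def by (metis Ints_of_int of_int_floor_le order_le_less) linarith
    moreover have "frac r = r - m" if "r \<in> {m<..<m + 1}" for r
      using that by (simp add: frac_unique_iff m_def)
    moreover have "Ck_on j ?U (\<lambda>(t, z). ham (turn_speed (t - m)) (2 * pi * (t - m)) z)" for j
      by (rule Ck_on_UNIV_subset) (intro smooth_ham Ck_on_compose_real[OF Ck_on_turn_speed] Ck_on_intros)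
    ultimately show ?thesis
      by (intro exI[of _ ?U] exI[of _ "\<lambda>(t, z). ham (turn_speed (t - m)) (2 * pi * (t - m)) z"])
         (auto simp: y open_Times)
  qed
qed

text \<open>Cauchy-Schwarz for (x_1, x_2) and the unit vector (\<open>cosw\<close>,
  \<open>sinw\<close>), with \<open>u2\<close> as the complementary component.\<close>

lemma u1_bound_torus:
  assumes "x \<in> sphere2" "w \<in> torus n"
  shows "\<bar>u1 s x p w\<bar> \<le> 1"
proof -
  have "(cosw s x p w)\<^sup>2 + (sinw s x p w)\<^sup>2 =
      ((Re (w k))\<^sup>2 + (Im (w k))\<^sup>2) * ((cos (phase s x p))\<^sup>2 + (sin (phase s x p))\<^sup>2)"
    unfolding cosw_def sinw_def by algebra
  also have "\<dots> = 1" using assms(2) k by (simp add: torus_def flip: cmod_power2)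
  finally have "(u1 s x p w)\<^sup>2 + (u2 s x p w)\<^sup>2 = (x $ 1)\<^sup>2 + (x $ 2)\<^sup>2"
    unfolding u1_def u2_def by algebra
  then have "(u1 s x p w)\<^sup>2 \<le> 1"
    using assms(1) zero_le_power2[of "u2 s x p w"] zero_le_power2[of "x $ 3"]
    unfolding sphere2_def mem_Collect_eq by linarith
  then show ?thesis by (simp add: abs_square_le_1)
qed

end

section \<open>Arbitrarily high Hamiltonians without orbits in the given class\<close>

section \<open>Capacity\<close>

lemma compact_sphere_box_torus: "compact (sphere2 \<times> ({p::rvec. (\<forall>i<n. p i \<in> {- r i..r i}) \<and> (\<forall>i\<ge>n. p i = 0)} \<times> torus n))"
  by (intro compact_Times sphere2_compact torus_compact compact_finite_seq) auto

text \<open>Openness of the box in R^n, in the form used by \<open>hamiltonian_vector_iff\<close>: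
  the smallest margin R_i - |p_i| bounds how far one may move along \<open>v\<close>.\<close>

lemma box_R_open:
  assumes "n > 0" "p \<in> box_R n R" "v \<in> euclid n"
  shows "\<exists>\<eta>>0. \<forall>s. \<bar>s\<bar> \<le> \<eta> \<longrightarrow> p + s *\<^sub>R v \<in> box_R n R"
proof -
  define c where "c = Min ((\<lambda>i. R i - \<bar>p i\<bar>) ` {..<n})"
  have "{..<n} \<noteq> {}" using assms(1) by auto
  then have c: "c > 0" "\<And>i. i < n \<Longrightarrow> c \<le> R i - \<bar>p i\<bar>"
    using assms(2) by (auto simp: c_def box_R_def Min_gr_iff simp del: lessThan_empty_iff)
  show ?thesis
  proof (intro exI[of _ "c / (norm v + 1)"] conjI allI impI)
    show "0 < c / (norm v + 1)" using c(1) by (auto intro!: divide_pos_pos add_nonneg_pos)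
    fix s :: real assume s: "\<bar>s\<bar> \<le> c / (norm v + 1)"
    have n: "norm v + 1 > 0" by (auto intro!: add_nonneg_pos)
    have "\<bar>p i + s * v i\<bar> < R i" if "i < n" for i
    proof -
      have "\<bar>v i\<bar> \<le> norm v" using norm_bounded[of v i] by simp
      then have "\<bar>s * v i\<bar> \<le> c / (norm v + 1) * norm v"
        unfolding abs_mult using s c(1) n by (intro mult_mono) auto
      also have "\<dots> < c" using c(1) n by (simp add: field_simps)
      finally show ?thesis using c(2)[OF that] by linarith
    qed
    then show "p + s *\<^sub>R v \<in> box_R n R"
      using assms by (auto simp: box_R_def euclid_def)
  qed
qed

text \<open>Shows that no threshold K is admissible in \<open>C_BPS\<close>. The width
  \<open>M\<close> is fixed before \<open>\<epsilon>\<close>, n, R, e and K, which is what makes E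
  uniform.\<close>

lemma large_hamiltonian_without_orbit:
  assumes M: "M > 0" "\<And>y. \<bar>y\<bar> \<le> 1 + 4 * pi \<Longrightarrow> bump (1 / M * y) = 1 \<and> deriv (\<lambda>y. bump (1 / M * y)) y = 0"
    "\<And>y. \<bar>deriv (\<lambda>y. bump (1 / M * y)) y\<bar> \<le> 1 / 4"
    and \<epsilon>: "\<epsilon> > 0" and R: "\<And>i. i < n \<Longrightarrow> R i > 0" and kR: "k < n" "R k > 2 * M" "e k \<noteq> 0"
  obtains H where "H \<in> Cc_smooth (sphere2 \<times> (box_R n R \<times> torus n))"
    "(INF (t, y)\<in>UNIV \<times> (C_eps \<epsilon> \<times> ({0} \<times> torus n)). ereal (H t y)) \<ge> ereal K"
    "periodic_orbits (sphere2 \<times> (box_R n R \<times> torus n)) (product_form area_form (omega0 n)) H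
      (class_0e sphere2 n R e) = {}"
proof -
  let ?N = "sphere2 \<times> (box_R n R \<times> torus n)"
  obtain D where D: "D > 0" "\<And>s. \<bar>deriv bump s\<bar> \<le> D" using bump_deriv_bounded by blast
  \<comment> \<open>The term of F can lower the value by at most 2 pi D, since
    |\<open>turn_speed\<close>| <= 2 pi D and |\<open>u1\<close>| <= 1.\<close>
  define K' where "K' = K + 2 * pi * D"
  \<comment> \<open>The bound 1 keeps orbits starting in |p_k| <= \<open>\<delta>\<close> on the
    plateau of \<open>\<rho>\<close>; the other bound places |J| <= \<open>\<delta>\<close> in the
    zero set of \<open>d\<close>.\<close>
  define \<delta> where "\<delta> = min 1 (pi * \<epsilon> / 2)"
  have \<delta>: "\<delta> > 0" "\<delta> \<le> 1" "\<delta> < pi * \<epsilon>" using \<epsilon> by (auto simp: \<delta>_def min_def)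
  define a where "a = (\<lambda>y. bump (2 / \<delta> * y))"
  \<comment> \<open>\<open>d\<close> is 0 for |J| <= pi \<open>\<epsilon>\<close> and 1 for |J| >= 2
    pi \<open>\<epsilon>\<close>; on \<open>C_eps\<close> with p = 0 one has exactly |J| = 2 pi
    \<open>\<epsilon>\<close>.\<close>
  define d where "d = (\<lambda>y. 1 - bump (1 / (pi * \<epsilon>) * y))"
  define \<rho> where "\<rho> = (\<lambda>y. bump (1 / M * y))"
  \<comment> \<open>\<open>A\<close> is supported in |p_i| <= R_i / 3, where \<open>L\<close> equals
    1, and \<open>L\<close> vanishes for |p_i| >= 2 R_i / 3.\<close>
  define cA where "cA = (\<lambda>i. 6 / R i)"
  define cL where "cL = (\<lambda>i. 3 / R i)"
  have da: "deriv a y = deriv bump (2 / \<delta> * y) * (2 / \<delta>)" for y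
    unfolding a_def by (rule DERIV_imp_deriv[OF scaled_bump_deriv])
  have dd: "deriv d y = - (deriv bump (1 / (pi * \<epsilon>) * y) * (1 / (pi * \<epsilon>)))" for y
    using DERIV_imp_deriv[OF DERIV_diff[OF DERIV_const[of 1] scaled_bump_deriv[of "1 / (pi * \<epsilon>)" y]]]
    by (simp only: d_def diff_0)
  interpret model n k K' cA cL a d \<rho>
    unfolding a_def d_def \<rho>_def
    by (unfold_locales; intro kR(1) Ck_on_diff Ck_on_const Ck_on_scaled_bump)
  define H where "H t = ham (turn_speed (frac t)) (2 * pi * frac t)" for t
  \<comment> \<open>Half-widths of a box that contains the support; in direction k it is that of
    \<open>\<rho>\<close>, and it fits because R_k > 2 M.\<close>
  define r where "r i = (if i = k then 2 * M else 2 * R i / 3)" for i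
  define Q where "Q = sphere2 \<times> ({p::rvec. (\<forall>i<n. p i \<in> {- r i..r i}) \<and> (\<forall>i\<ge>n. p i = 0)} \<times> torus n)"
  have rR: "r i < R i" if "i < n" for i
    using R[OF that] kR(2) by (auto simp: r_def)
  have "Q \<subseteq> ?N"
  proof -
    have "p \<in> box_R n R" if "\<forall>i<n. p i \<in> {- r i..r i}" "\<forall>i\<ge>n. p i = 0" for p :: rvec
      using that rR by (fastforce simp: box_R_def euclid_def abs_less_iff)
    then show ?thesis by (auto simp: Q_def)
  qed
  moreover have "H t z = 0" if z: "z \<in> ?N - Q" for t z
  proof -
    obtain x p w where [simp]: "z = (x, p, w)" by (cases z)
    obtain i where i: "i < n" "\<bar>p i\<bar> > r i"
      using z by (auto simp: Q_def box_R_def euclid_def not_le abs_le_iff)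
    show ?thesis
    proof (cases "i = k")
      case True
      \<comment> \<open>At 1 + 4 pi the cutoff is 1, but from 2 M on it is 0. Hence
        \<open>\<delta>\<close> < 2 M, and \<open>a\<close> vanishes beyond 2 M too.\<close>
      have "\<not> 2 * M \<le> 1 + 4 * pi"
        using M(2)[of "1 + 4 * pi"] bump_eq_0[of "1 / M * (1 + 4 * pi)"] M(1) by (auto simp: field_simps)
      moreover have "\<bar>p k\<bar> > 2 * M" using i True by (simp add: r_def)
      ultimately have "\<bar>p k\<bar> > 2 * M" "\<bar>p k\<bar> > \<delta>"
        using \<delta>(2) pi_gt_zero by linarith+
      then have "\<rho> (p k) = 0" "a (p k) = 0"
        using M(1) \<delta>(1) by (auto simp: \<rho>_def a_def abs_mult field_simps intro!: bump_eq_0)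
      then show ?thesis by (simp add: H_def ham_def)
    next
      case False
      then have "\<bar>p i\<bar> > 2 * R i / 3" and iI: "i \<in> I" using i by (auto simp: r_def I_def)
      then have "bump (cA i * p i) = 0" "bump (cL i * p i) = 0"
        using R[OF i(1)] by (auto simp: cA_def cL_def abs_mult field_simps intro!: bump_eq_0)
      then have "A p = 0" "L p = 0"
        using iI finite_I by (auto simp: A_def L_def)
      then show ?thesis by (simp add: H_def ham_def)
    qed
  qed
  moreover have "compact Q" unfolding Q_def by (rule compact_sphere_box_torus)
  moreover have "smooth_on (UNIV \<times> ?N) (\<lambda>(t, z). H t z)"
    unfolding H_def by (rule smooth_ham_frac)
  moreover have "H (t + 1) z = H t z" for t z by (simp add: H_def frac_1_eq)
  ultimately have "H \<in> Cc_smooth ?N"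
    unfolding Cc_smooth_def by blast
  \<comment> \<open>For \<open>\<epsilon>\<close> > 1 the set is empty and the infimum is infinite;
    \<open>INF_greatest\<close> covers this case as well.\<close>
  moreover have "ereal K \<le> (INF (t, y)\<in>UNIV \<times> (C_eps \<epsilon> \<times> ({0} \<times> torus n)). ereal (H t y))"
  proof (rule INF_greatest, clarify)
    fix t :: real and x w assume x: "x \<in> C_eps \<epsilon>" and w: "w \<in> torus n"
    have x': "x \<in> sphere2" "\<bar>x $ 3\<bar> = \<epsilon>" using x \<epsilon> by (auto simp: C_eps_def)
    have "A 0 = K'" "L 0 = 1" "a 0 = 1" "\<rho> 0 = 1" by (auto simp: A_def L_def a_def \<rho>_def bump_eq_1)
    moreover have "d (- 2 * pi * x $ 3) = 1"
      using x'(2) \<epsilon> by (auto simp: d_def abs_mult intro!: bump_eq_0)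
    ultimately have "H t (x, 0, w) = K' + turn_speed (frac t) * u1 (2 * pi * frac t) x 0 w"
      by (simp add: H_def ham_def)
    moreover have "\<bar>turn_speed (frac t) * u1 (2 * pi * frac t) x 0 w\<bar> \<le> 2 * pi * D * 1"
      unfolding abs_mult using D x' w u1_bound_torus
      by (intro mult_mono) (auto simp: turn_speed_def abs_mult)
    ultimately show "ereal K \<le> ereal (H t (x, 0, w))" by (simp add: K'_def)
  qed
  moreover have "periodic_orbits ?N (product_form area_form (omega0 n)) H (class_0e sphere2 n R e) = {}"
  proof (rule ccontr)
    assume "\<not> ?thesis"
    then obtain z where z: "z \<in> class_0e sphere2 n R e" "\<And>t. z (t + 1) = z t"
        "integral_curve ?N (product_form area_form (omega0 n)) H z"
      by (auto simp: periodic_orbits_def)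
    have "e k = 0"
    proof (rule no_winding_orbit[where P = "box_R n R" and \<delta> = \<delta> and z = z])
      show "box_R n R \<subseteq> euclid n" by (auto simp: box_R_def)
      show "\<And>p v. p \<in> box_R n R \<Longrightarrow> v \<in> euclid n \<Longrightarrow> \<exists>\<eta>>0. \<forall>s. \<bar>s\<bar> \<le> \<eta> \<longrightarrow> p + s *\<^sub>R v \<in> box_R n R"
        using kR(1) by (intro box_R_open) auto
      show "integral_curve ?N (product_form area_form (omega0 n))
          (\<lambda>t. ham (turn_speed (frac t)) (2 * pi * frac t)) z"
        using z(3) by (simp add: H_def[abs_def])
      show "z 1 = z 0" using z(2)[of 0] by simp
      show "homotopic_loops (torus n) (snd \<circ> snd \<circ> z) (torus_loop n e)"
        using z(1) by (simp add: class_0e_def)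
      show "a y = 0 \<and> deriv a y = 0" if "\<bar>y\<bar> > \<delta>" for y
      proof -
        have "\<bar>2 / \<delta> * y\<bar> > 2" using that \<delta>(1) by (simp add: abs_mult field_simps)
        then have "bump (2 / \<delta> * y) = 0" "deriv bump (2 / \<delta> * y) = 0"
          by (intro bump_eq_0 bump_deriv_eq_0; linarith)+
        then have "a y = 0" "deriv a y = 0" unfolding da by (simp_all only: a_def mult_zero_left)
        then show ?thesis ..
      qed
      show "d y = 0 \<and> deriv d y = 0" if "\<bar>y\<bar> \<le> \<delta>" for y
      proof -
        have "\<bar>1 / (pi * \<epsilon>) * y\<bar> < 1" using that \<delta>(3) \<epsilon> by (simp add: abs_mult field_simps)
        then have "bump (1 / (pi * \<epsilon>) * y) = 1" "deriv bump (1 / (pi * \<epsilon>) * y) = 0"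
          by (intro bump_eq_1 bump_deriv_eq_0; linarith)+
        then have "d y = 0" "deriv d y = 0" unfolding dd by (simp_all only: d_def mult_zero_left)
        then show ?thesis ..
      qed
      show "\<rho> y = 1 \<and> deriv \<rho> y = 0" if "\<bar>y\<bar> \<le> \<delta> + 4 * pi" for y
        using M(2)[of y] that \<delta>(2) by (simp add: \<rho>_def)
      show "\<bar>deriv \<rho> y\<bar> \<le> 1 / 4" for y using M(3) by (simp add: \<rho>_def)
      show "L p = 1" if "A p \<noteq> 0" for p
      proof -
        have "bump (cL i * p i) = 1" if i: "i \<in> I" for i
        proof -
          have "bump (cA i * p i) \<noteq> 0" using \<open>A p \<noteq> 0\<close> i finite_I by (auto simp: A_def)
          then have "\<bar>cA i * p i\<bar> < 2" using bump_eq_0 by (meson not_le)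
          then have "\<bar>cL i * p i\<bar> \<le> 1" by (simp add: cA_def cL_def abs_mult)
          then show ?thesis by (rule bump_eq_1)
        qed
        then show ?thesis by (simp add: L_def)
      qed
    qed
    with kR(3) show False by simp
  qed
  ultimately show thesis by (rule that)
qed

text \<open>E = 2 M for the width \<open>M\<close> of \<open>wide_bump\<close>. The set of
  admissible thresholds is empty, and its infimum is infinity.\<close>

lemma capacity_infinite:
  obtains E where "E > 0"
    "\<And>\<epsilon> n R e k. \<epsilon> > 0 \<Longrightarrow> (\<And>i. i < n \<Longrightarrow> R i > 0) \<Longrightarrow> k < n \<Longrightarrow> R k > E \<Longrightarrow> e k \<noteq> 0 \<Longrightarrow>
      capacity sphere2 area_form (C_eps \<epsilon>) n R e = \<infinity>"
proof -
  obtain M where M: "M > 0" "\<And>y. \<bar>y\<bar> \<le> 1 + 4 * pi \<Longrightarrow> bump (1 / M * y) = 1 \<and> deriv (\<lambda>y. bump (1 / M * y)) y = 0"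
    "\<And>y. \<bar>deriv (\<lambda>y. bump (1 / M * y)) y\<bar> \<le> 1 / 4"
    using wide_bump by blast
  show thesis
  proof (rule that[of "2 * M"])
    show "2 * M > 0" using M(1) by simp
    fix \<epsilon> :: real and n :: nat and R :: "nat \<Rightarrow> real" and e :: "nat \<Rightarrow> int" and k
    assume "\<epsilon> > 0" "\<And>i. i < n \<Longrightarrow> R i > 0" "k < n" "R k > 2 * M" "e k \<noteq> 0"
    then have "\<exists>H\<in>Cc_smooth (sphere2 \<times> (box_R n R \<times> torus n)).
      (INF (t, y)\<in>UNIV \<times> (C_eps \<epsilon> \<times> ({0} \<times> torus n)). ereal (H t y)) \<ge> ereal K \<and>
      periodic_orbits (sphere2 \<times> (box_R n R \<times> torus n)) (product_form area_form (omega0 n)) H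
        (class_0e sphere2 n R e) = {}" for K
      using large_hamiltonian_without_orbit[OF M] by metis
    then have "{ereal K | K. K > 0 \<and>
      (\<forall>H\<in>Cc_smooth (sphere2 \<times> (box_R n R \<times> torus n)).
        (INF (t, y)\<in>UNIV \<times> (C_eps \<epsilon> \<times> ({0} \<times> torus n)). ereal (H t y)) \<ge> ereal K
        \<longrightarrow> periodic_orbits (sphere2 \<times> (box_R n R \<times> torus n)) (product_form area_form (omega0 n)) H
          (class_0e sphere2 n R e) \<noteq> {})} = {}"
      by blast
    then show "capacity sphere2 area_form (C_eps \<epsilon>) n R e = \<infinity>"
      unfolding capacity_def C_BPS_def by (simp only: Inf_empty top_ereal_def)
  qed
qed

section \<open>Global flow of the rotation Hamiltonian and displacement by a half turn\<close>

section \<open>Stable displaceability\<close>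

text \<open>Boundedness is carried along because it makes products of Lipschitz functions
  Lipschitz.\<close>

definition bounded_lipschitz :: "('a::real_normed_vector \<Rightarrow> real) \<Rightarrow> bool" where
  "bounded_lipschitz f \<longleftrightarrow> (\<exists>B. \<forall>x. \<bar>f x\<bar> \<le> B) \<and> (\<exists>L. \<forall>x y. \<bar>f x - f y\<bar> \<le> L * norm (x - y))"

lemma bounded_lipschitzI:
  "(\<And>x. \<bar>f x\<bar> \<le> B) \<Longrightarrow> (\<And>x y. \<bar>f x - f y\<bar> \<le> L * norm (x - y)) \<Longrightarrow> bounded_lipschitz f"
  unfolding bounded_lipschitz_def by blast

lemma bounded_lipschitz_const: "bounded_lipschitz (\<lambda>x. c)"
  by (rule bounded_lipschitzI[of _ "\<bar>c\<bar>" 0]) auto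

lemma bounded_lipschitz_add:
  assumes "bounded_lipschitz f" "bounded_lipschitz g"
  shows "bounded_lipschitz (\<lambda>x. f x + g x)"
proof -
  obtain B L B' L' where f: "\<And>x. \<bar>f x\<bar> \<le> B" "\<And>x y. \<bar>f x - f y\<bar> \<le> L * norm (x - y)"
    and g: "\<And>x. \<bar>g x\<bar> \<le> B'" "\<And>x y. \<bar>g x - g y\<bar> \<le> L' * norm (x - y)"
    using assms unfolding bounded_lipschitz_def by blast
  show ?thesis
  proof (rule bounded_lipschitzI)
    show "\<bar>f x + g x\<bar> \<le> B + B'" for x using f(1)[of x] g(1)[of x] by linarith
    show "\<bar>f x + g x - (f y + g y)\<bar> \<le> (L + L') * norm (x - y)" for x y
      using f(2)[of x y] g(2)[of x y] unfolding distrib_right by linarith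
  qed
qed

lemma bounded_lipschitz_mult:
  assumes "bounded_lipschitz f" "bounded_lipschitz g"
  shows "bounded_lipschitz (\<lambda>x. f x * g x)"
proof -
  obtain B L B' L' where f: "\<And>x. \<bar>f x\<bar> \<le> B" "\<And>x y. \<bar>f x - f y\<bar> \<le> L * norm (x - y)"
    and g: "\<And>x. \<bar>g x\<bar> \<le> B'" "\<And>x y. \<bar>g x - g y\<bar> \<le> L' * norm (x - y)"
    using assms unfolding bounded_lipschitz_def by blast
  have B: "B \<ge> 0" "B' \<ge> 0" using f(1)[of 0] g(1)[of 0] by linarith+
  show ?thesis
  proof (rule bounded_lipschitzI)
    show "\<bar>f x * g x\<bar> \<le> B * B'" for x
      unfolding abs_mult using f(1) g(1) B by (intro mult_mono) auto
    fix x y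
    have "f x * g x - f y * g y = f x * (g x - g y) + (f x - f y) * g y" by (simp add: algebra_simps)
    then have "\<bar>f x * g x - f y * g y\<bar> \<le> \<bar>f x\<bar> * \<bar>g x - g y\<bar> + \<bar>f x - f y\<bar> * \<bar>g y\<bar>"
      by (metis abs_mult abs_triangle_ineq)
    also have "\<dots> \<le> B * (L' * norm (x - y)) + L * norm (x - y) * B'"
      using f g B by (intro add_mono mult_mono) (auto intro: order_trans[OF abs_ge_zero])
    finally show "\<bar>f x * g x - f y * g y\<bar> \<le> (B * L' + L * B') * norm (x - y)"
      by (simp add: algebra_simps)
  qed
qed

lemma bounded_lipschitz_minus: "bounded_lipschitz f \<Longrightarrow> bounded_lipschitz (\<lambda>x. - f x)"
  using bounded_lipschitz_mult[OF bounded_lipschitz_const[of "-1"]] by simp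

lemma bounded_lipschitz_diff:
  "bounded_lipschitz f \<Longrightarrow> bounded_lipschitz g \<Longrightarrow> bounded_lipschitz (\<lambda>x. f x - g x)"
  using bounded_lipschitz_add[OF _ bounded_lipschitz_minus, of f g] by simp

lemma bounded_lipschitz_real:
  fixes f :: "real \<Rightarrow> real"
  assumes "\<And>y. (f has_real_derivative f' y) (at y)" "\<And>y. \<bar>f' y\<bar> \<le> L" "\<And>y. \<bar>f y\<bar> \<le> B"
    and l: "bounded_linear l"
  shows "bounded_lipschitz (\<lambda>x. f (l x))"
proof -
  obtain C where C: "\<And>x. norm (l x) \<le> norm x * C" using bounded_linear.bounded[OF l] by blast
  have L: "L \<ge> 0" using assms(2)[of 0] by linarith
  have lip: "\<bar>f x - f y\<bar> \<le> L * \<bar>x - y\<bar>" for x y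
    using field_differentiable_bound[of UNIV f f' L x y] assms(1,2) by simp
  have "\<bar>f (l x) - f (l y)\<bar> \<le> (L * C) * norm (x - y)" for x y
  proof -
    have "\<bar>l x - l y\<bar> \<le> norm (x - y) * C"
      using C[of "x - y"] by (simp add: linear_diff[OF bounded_linear.linear[OF l]])
    then have "L * \<bar>l x - l y\<bar> \<le> L * (norm (x - y) * C)" using L by (rule mult_left_mono)
    then show ?thesis using lip[of "l x" "l y"] by (simp add: mult_ac)
  qed
  with assms(3) show ?thesis by (intro bounded_lipschitzI[of _ B]) auto
qed

text \<open>The retraction to the unit ball makes the vector field below globally Lipschitz.\<close>

lemma bounded_lipschitz_retract:
  "bounded_lipschitz (\<lambda>(y::real^3, r::'b::real_normed_vector). y $ i / max 1 (norm y))"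
proof -
  let ?g = "\<lambda>y::real^3. y $ i / max 1 (norm y)"
  have bound: "\<bar>?g y\<bar> \<le> 1" for y
    using component_le_norm_cart[of y i] by (simp add: abs_divide divide_le_eq) linarith
  have lip: "\<bar>?g x - ?g y\<bar> \<le> 2 * norm (x - y)" for x y
  proof -
    let ?m = "max 1 (norm x)" and ?k = "max 1 (norm y)"
    \<comment> \<open>Separates the change of the numerator from that of the denominator; each is at
      most norm (x - y).\<close>
    have "a / m - b / k = (a - b) / m + b / k * ((k - m) / m)" if "m > 0" "k > 0" for a b m k :: real
      using that by (simp add: field_simps)
    from this[of ?m ?k "x $ i" "y $ i"]
    have "?g x - ?g y = (x $ i - y $ i) / ?m + ?g y * ((?k - ?m) / ?m)" by simp
    then have "\<bar>?g x - ?g y\<bar> \<le> \<bar>(x $ i - y $ i) / ?m\<bar> + \<bar>?g y\<bar> * \<bar>(?k - ?m) / ?m\<bar>"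
      by (metis abs_mult abs_triangle_ineq)
    also have "\<dots> \<le> norm (x - y) + 1 * norm (x - y)"
    proof (intro add_mono mult_mono bound)
      show "\<bar>(x $ i - y $ i) / ?m\<bar> \<le> norm (x - y)"
        using component_le_norm_cart[of "x - y" i] mult_left_mono[of 1 ?m "norm (x - y)"]
        by (simp add: abs_divide divide_le_eq)
      have "\<bar>?k - ?m\<bar> \<le> norm (x - y)"
        using norm_triangle_ineq3[of x y] by (auto simp: max_def abs_if split: if_splits)
      then show "\<bar>(?k - ?m) / ?m\<bar> \<le> norm (x - y)"
        using mult_left_mono[of 1 ?m "norm (x - y)"]
        by (simp add: abs_divide divide_le_eq)
    qed auto
    finally show ?thesis by simp
  qed
  show ?thesis
  proof (rule bounded_lipschitzI)
    show "\<bar>case x of (y, r::'b) \<Rightarrow> ?g y\<bar> \<le> 1" for x using bound by (auto split: prod.split)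
    fix x y :: "(real^3) \<times> 'b"
    have "norm (fst x - fst y) \<le> norm (x - y)" by (metis fst_diff norm_fst_le prod.collapse)
    then show "\<bar>(case x of (y, r) \<Rightarrow> ?g y) - (case y of (y, r) \<Rightarrow> ?g y)\<bar> \<le> 2 * norm (x - y)"
      using lip[of "fst x" "fst y"] by (simp add: split_beta)
  qed
qed

text \<open>The flow of F with amplitude pi, with the angle q lifted to the real line. A globally
  Lipschitz field is solved that agrees with the wanted one on the unit sphere, and the solution
  never leaves that sphere.\<close>

lemma rotation_flow:
  fixes M :: real and x :: "real^3" and p q :: real
  assumes x: "x \<in> sphere2" 
  defines "\<rho> \<equiv> \<lambda>y. bump (1 / M * y)"
  obtains X P Q where "X 0 = x" "P 0 = p" "Q 0 = q" "\<And>t. X t \<in> sphere2"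
    "\<And>t. (X has_vector_derivative cross3 (X t) (vector [pi * \<rho> (P t) * cos (2 * pi * Q t),
        pi * \<rho> (P t) * sin (2 * pi * Q t), 0])) (at t)"
    "\<And>t. (P has_real_derivative
        - (2 * pi * (pi * \<rho> (P t) * (X t $ 2 * cos (2 * pi * Q t) - X t $ 1 * sin (2 * pi * Q t))))) (at t)"
    "\<And>t. (Q has_real_derivative
        pi * deriv \<rho> (P t) * (X t $ 1 * cos (2 * pi * Q t) + X t $ 2 * sin (2 * pi * Q t))) (at t)"
proof -
  define g where "g i = (\<lambda>(y::real^3, r::real \<times> real). y $ i / max 1 (norm y))" for i :: 3
  define c where "c = (\<lambda>z::(real^3) \<times> real \<times> real. cos (2 * pi * snd (snd z)))"
  define s where "s = (\<lambda>z::(real^3) \<times> real \<times> real. sin (2 * pi * snd (snd z)))"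
  define h where "h = (\<lambda>z::(real^3) \<times> real \<times> real. \<rho> (fst (snd z)))"
  define h' where "h' = (\<lambda>z::(real^3) \<times> real \<times> real. deriv \<rho> (fst (snd z)))"
  have d\<rho>: "deriv \<rho> = (\<lambda>y. deriv bump (1 / M * y) * (1 / M))"
    unfolding \<rho>_def by (intro ext DERIV_imp_deriv scaled_bump_deriv)
  obtain D1 where D1: "\<And>s. \<bar>deriv bump s\<bar> \<le> D1" using bump_deriv_bounded by blast
  obtain D2 where D2: "\<And>s. \<bar>deriv (deriv bump) s\<bar> \<le> D2" using bump_deriv2_bounded by blast
  have lin: "bounded_linear (\<lambda>z::(real^3) \<times> real \<times> real. fst (snd z))"
    "bounded_linear (\<lambda>z::(real^3) \<times> real \<times> real. snd (snd z))"
    by (intro bounded_linear_compose[OF bounded_linear_fst bounded_linear_snd]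
        bounded_linear_compose[OF bounded_linear_snd bounded_linear_snd])+
  have bl_g: "bounded_lipschitz (g i)" for i
    unfolding g_def by (rule bounded_lipschitz_retract)
  have bl_c: "bounded_lipschitz c" unfolding c_def
    by (rule bounded_lipschitz_real[of "\<lambda>y. cos (2 * pi * y)" "\<lambda>y. - (2 * pi * sin (2 * pi * y))" "2 * pi" 1, OF _ _ _ lin(2)])
       (auto intro!: derivative_eq_intros simp: abs_mult)
  have bl_s: "bounded_lipschitz s" unfolding s_def
    by (rule bounded_lipschitz_real[of "\<lambda>y. sin (2 * pi * y)" "\<lambda>y. 2 * pi * cos (2 * pi * y)" "2 * pi" 1, OF _ _ _ lin(2)])
       (auto intro!: derivative_eq_intros simp: abs_mult)
  have bl_h: "bounded_lipschitz h" unfolding h_def \<rho>_def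
  proof (rule bounded_lipschitz_real[OF scaled_bump_deriv _ _ lin(1)])
    show "\<bar>deriv bump (1 / M * y) * (1 / M)\<bar> \<le> D1 * \<bar>1 / M\<bar>" for y
      unfolding abs_mult by (intro mult_right_mono D1) auto
    show "\<bar>bump (1 / M * y)\<bar> \<le> 1" for y
      using bump_nonneg[of "1 / M * y"] bump_le_1[of "1 / M * y"] by linarith
  qed
  have bl_h': "bounded_lipschitz h'" unfolding h'_def d\<rho>
  proof (rule bounded_lipschitz_real[OF _ _ _ lin(1), of _
        "\<lambda>y. deriv (deriv bump) (1 / M * y) * (1 / M) * (1 / M)" "D2 * \<bar>1 / M\<bar> * \<bar>1 / M\<bar>" "D1 * \<bar>1 / M\<bar>"])
    fix y
    have "((\<lambda>y. 1 / M * y) has_real_derivative 1 / M) (at y)" by (rule DERIV_cmult_Id)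
    from DERIV_cmult_right[OF DERIV_chain2[OF Ck_on_deriv(1)[OF Ck_on_deriv(2)[OF Ck_on_bump]] this]]
    show "((\<lambda>y. deriv bump (1 / M * y) * (1 / M)) has_real_derivative
        deriv (deriv bump) (1 / M * y) * (1 / M) * (1 / M)) (at y)" .
    show "\<bar>deriv (deriv bump) (1 / M * y) * (1 / M) * (1 / M)\<bar> \<le> D2 * \<bar>1 / M\<bar> * \<bar>1 / M\<bar>"
      unfolding abs_mult by (intro mult_right_mono D2) auto
    show "\<bar>deriv bump (1 / M * y) * (1 / M)\<bar> \<le> D1 * \<bar>1 / M\<bar>"
      unfolding abs_mult by (intro mult_right_mono D1) auto
  qed
  \<comment> \<open>The wanted field with x replaced by its retraction \<open>g\<close>.\<close>
  define F where "F z = (vector [- g 3 z * (pi * h z * s z), g 3 z * (pi * h z * c z),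
      g 1 z * (pi * h z * s z) - g 2 z * (pi * h z * c z)] :: real^3,
      - (2 * pi * (pi * h z * (g 2 z * c z - g 1 z * s z))),
      pi * h' z * (g 1 z * c z + g 2 z * s z))" for z
  have bl: "bounded_lipschitz (\<lambda>z. fst (F z) $ i)" "bounded_lipschitz (\<lambda>z. fst (snd (F z)))"
    "bounded_lipschitz (\<lambda>z. snd (snd (F z)))" for i
  proof -
    have "bounded_lipschitz (\<lambda>z. fst (F z) $ 1)" "bounded_lipschitz (\<lambda>z. fst (F z) $ 2)"
      "bounded_lipschitz (\<lambda>z. fst (F z) $ 3)"
      unfolding F_def fst_conv vector_3
      by (intro bounded_lipschitz_mult bounded_lipschitz_diff bounded_lipschitz_minus bounded_lipschitz_const
          bl_g bl_c bl_s bl_h)+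
    then show "bounded_lipschitz (\<lambda>z. fst (F z) $ i)" using exhaust_3[of i] by auto
    show "bounded_lipschitz (\<lambda>z. fst (snd (F z)))" "bounded_lipschitz (\<lambda>z. snd (snd (F z)))"
      unfolding F_def fst_conv snd_conv
      by (intro bounded_lipschitz_mult bounded_lipschitz_add bounded_lipschitz_diff bounded_lipschitz_minus
          bounded_lipschitz_const bl_g bl_c bl_s bl_h bl_h')+
  qed
  obtain L where L: "\<And>x y i. \<bar>fst (F x) $ i - fst (F y) $ i\<bar> \<le> L i * norm (x - y)"
    using bl(1) unfolding bounded_lipschitz_def by metis
  obtain L2 where L2: "\<And>x y. \<bar>fst (snd (F x)) - fst (snd (F y))\<bar> \<le> L2 * norm (x - y)"
    using bl(2) unfolding bounded_lipschitz_def by blast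
  obtain L3 where L3: "\<And>x y. \<bar>snd (snd (F x)) - snd (snd (F y))\<bar> \<le> L3 * norm (x - y)"
    using bl(3) unfolding bounded_lipschitz_def by blast
  have lip: "norm (F x - F y) \<le> ((\<Sum>i\<in>UNIV. L i) + L2 + L3) * norm (x - y)" for x y
  proof -
    have "norm (F x - F y) \<le> norm (fst (F x - F y)) + (norm (fst (snd (F x - F y))) + norm (snd (snd (F x - F y))))"
      using norm_Pair_le[of "fst (F x - F y)" "snd (F x - F y)"]
        norm_Pair_le[of "fst (snd (F x - F y))" "snd (snd (F x - F y))"]
      unfolding prod.collapse by linarith
    also have "norm (fst (F x - F y)) \<le> (\<Sum>i\<in>UNIV. \<bar>fst (F x - F y) $ i\<bar>)" by (rule norm_le_l1_cart)
    also have "\<dots> \<le> (\<Sum>i\<in>UNIV. L i * norm (x - y))" using L by (intro sum_mono) simp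
    finally show ?thesis
      using L2[of x y] L3[of x y] by (simp add: sum_distrib_right distrib_right)
  qed
  obtain y where y: "y 0 = (x, p, q)" "\<And>t. (y has_vector_derivative F (y t)) (at t)"
    using global_solution[OF lip] by blast
  define X P Q where "X t = fst (y t)" and "P t = fst (snd (y t))" and "Q t = snd (snd (y t))" for t
  have yt: "y t = (X t, P t, Q t)" for t by (simp add: X_def P_def Q_def)
  have dX: "(X has_vector_derivative fst (F (y t))) (at t)"
    and dP: "(P has_real_derivative fst (snd (F (y t)))) (at t)"
    and dQ: "(Q has_real_derivative snd (snd (F (y t)))) (at t)" for t
    unfolding X_def[abs_def] P_def[abs_def] Q_def[abs_def] has_real_derivative_iff_has_vector_derivative
    by (intro has_vector_derivative_component[OF y(2)] lin bounded_linear_fst)+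
  have "X t \<bullet> X t = X 0 \<bullet> X 0" for t
  proof (rule DERIV_isconst_all[of "\<lambda>t. X t \<bullet> X t"], intro allI)
    fix t
    \<comment> \<open>The sphere part of \<open>F\<close> is a cross product whose first factor is a
      multiple of X, so it is orthogonal to X.\<close>
    have "X t \<bullet> fst (F (y t)) = 0"
      by (simp add: F_def g_def yt inner_vec_def sum_3 vector_3 algebra_simps)
    then show "((\<lambda>t. X t \<bullet> X t) has_real_derivative 0) (at t)"
      using bounded_bilinear.has_vector_derivative[OF bounded_bilinear_inner dX dX, of t]
      by (simp add: has_real_derivative_iff_has_vector_derivative inner_commute)
  qed
  then have X1: "X t \<in> sphere2" for t using x by (simp add: sphere2_iff X_def y(1))
  then have "norm (X t) = 1" for t by (simp add: sphere2_iff norm_eq_sqrt_inner)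
  then have g: "g i (y t) = X t $ i" for i t by (simp add: g_def yt)
  show thesis
  proof (rule that[of X P Q])
    show "X 0 = x" "P 0 = p" "Q 0 = q" by (simp_all add: X_def P_def Q_def y(1))
    fix t
    show "X t \<in> sphere2" by (rule X1)
    have "fst (F (y t)) = cross3 (X t) (vector [pi * \<rho> (P t) * cos (2 * pi * Q t), pi * \<rho> (P t) * sin (2 * pi * Q t), 0])"
      unfolding vec_eq_iff forall_3 cross_components vector_3 F_def fst_conv g
      by (simp add: h_def c_def s_def yt)
    then show "(X has_vector_derivative cross3 (X t) (vector [pi * \<rho> (P t) * cos (2 * pi * Q t),
        pi * \<rho> (P t) * sin (2 * pi * Q t), 0])) (at t)"
      using dX[of t] by simp
    show "(P has_real_derivative
        - (2 * pi * (pi * \<rho> (P t) * (X t $ 2 * cos (2 * pi * Q t) - X t $ 1 * sin (2 * pi * Q t))))) (at t)"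
      using dP[of t] by (simp only: F_def fst_conv snd_conv g) (simp add: h_def c_def s_def yt)
    show "(Q has_real_derivative
        pi * deriv \<rho> (P t) * (X t $ 1 * cos (2 * pi * Q t) + X t $ 2 * sin (2 * pi * Q t))) (at t)"
      using dQ[of t] by (simp only: F_def fst_conv snd_conv g) (simp add: h'_def c_def s_def yt)
  qed
qed

text \<open>Both the set and its closure lie in p = 0, while the half turn moves a point with p = 0
  to p = - 4 pi x_3, which is nonzero because |x_3| = \<open>\<epsilon>\<close>.\<close>

lemma C_eps_stably_displaceable:
  assumes \<epsilon>: "\<epsilon> > 0"
  shows "stably_displaceable sphere2 area_form (C_eps \<epsilon>)"
proof -
  let ?N = "sphere2 \<times> (euclid 1 \<times> torus 1)" and ?\<omega> = "product_form area_form (omega0 1)"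
  note One_nat_def [simp del]
  let ?Z = "C_eps \<epsilon> \<times> ({0::rvec} \<times> torus 1)"
  obtain M where M: "M > 0" "\<And>y. \<bar>y\<bar> \<le> 1 + 4 * pi \<Longrightarrow> bump (1 / M * y) = 1 \<and> deriv (\<lambda>y. bump (1 / M * y)) y = 0"
    using wide_bump by metis
  define \<rho> where "\<rho> = (\<lambda>y. bump (1 / M * y))"
  \<comment> \<open>The case f = 0: \<open>A\<close> vanishes, \<open>L\<close> is an empty product,
    and only the autonomous Hamiltonian F with amplitude pi remains.\<close>
  interpret model 1 0 0 "\<lambda>_. 0" "\<lambda>_. 0" "\<lambda>_. 0" "\<lambda>_. 0" \<rho>
    unfolding \<rho>_def by (unfold_locales; intro Ck_on_const Ck_on_scaled_bump zero_less_one)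
  have A: "A p = 0" and L: "L p = 1" for p
    unfolding A_def L_def I_def by simp_all
  have ham_s: "ham b s = ham b 0" for b s
    by (intro ext) (simp add: ham_def u1_def cosw_def sinw_def phase_def A split_beta)
  have P_open: "\<exists>\<eta>>0. \<forall>s. \<bar>s\<bar> \<le> \<eta> \<longrightarrow> p + s *\<^sub>R v \<in> euclid 1" if "p \<in> euclid 1" "v \<in> euclid 1" for p v
    using that by (intro exI[of _ 1]) (auto simp: euclid_def)
  define H where "H t = ham pi 0" for t :: real
  have "H \<in> Cc_smooth ?N"
  proof -
    define Q where "Q = sphere2 \<times> ({p::rvec. (\<forall>i<1. p i \<in> {- (2 * M)..2 * M}) \<and> (\<forall>i\<ge>1. p i = 0)} \<times> torus 1)"
    have "compact Q" unfolding Q_def by (rule compact_sphere_box_torus)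
    moreover have "Q \<subseteq> ?N" by (auto simp: Q_def euclid_def)
    moreover have "H t z = 0" if z: "z \<in> ?N - Q" for t z
    proof -
      obtain x p w where [simp]: "z = (x, p, w)" by (cases z)
      have "\<bar>p 0\<bar> > 2 * M" using z by (auto simp: Q_def euclid_def)
      then have "\<rho> (p 0) = 0"
        using M(1) by (auto simp: \<rho>_def abs_mult field_simps intro!: bump_eq_0)
      then show ?thesis by (simp add: H_def ham_def A)
    qed
    moreover have "smooth_on (UNIV \<times> ?N) (\<lambda>(t, z). H t z)"
      unfolding H_def by (intro smooth_on_Ck_UNIV smooth_ham Ck_on_const)
    ultimately show ?thesis unfolding Cc_smooth_def H_def by blast
  qed
  \<comment> \<open>\<open>rotation_flow\<close> starts at q = Arg(w) / (2 pi), and cis (2 pi Q)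
    carries the lifted solution back to the circle.\<close>
  moreover have "\<exists>y. y 0 = z \<and> integral_curve ?N ?\<omega> H y" if z: "z \<in> ?N" for z
  proof -
    obtain x p w where zx: "z = (x, p, w)" by (cases z)
    have x: "x \<in> sphere2" and p: "p \<in> euclid 1" and w: "w \<in> torus 1" using z zx by auto
    obtain X P Q where X0: "X 0 = x" "P 0 = p 0" "Q 0 = Arg (w 0) / (2 * pi)" and X: "\<And>t. X t \<in> sphere2"
      and dX: "\<And>t. (X has_vector_derivative cross3 (X t) (vector [pi * \<rho> (P t) * cos (2 * pi * Q t),
        pi * \<rho> (P t) * sin (2 * pi * Q t), 0])) (at t)"
      and dP: "\<And>t. (P has_real_derivative
        - (2 * pi * (pi * \<rho> (P t) * (X t $ 2 * cos (2 * pi * Q t) - X t $ 1 * sin (2 * pi * Q t))))) (at t)"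
      and dQ: "\<And>t. (Q has_real_derivative
        pi * deriv \<rho> (P t) * (X t $ 1 * cos (2 * pi * Q t) + X t $ 2 * sin (2 * pi * Q t))) (at t)"
      unfolding \<rho>_def by (rule rotation_flow[OF x]) blast
    define y where "y t = (X t, unit_seq 0 (P t) :: rvec, unit_seq 0 (cis (2 * pi * Q t)) :: cvec)" for t
    have "unit_seq 0 (p 0) = p" using p by (auto intro!: bcontfun_eqI simp: euclid_def)
    moreover have "unit_seq 0 (cis (Arg (w 0))) = w"
    proof -
      have "cmod (w 0) = 1" using w by (simp add: torus_def)
      then have "cis (Arg (w 0)) = w 0" by (subst cis_Arg) (auto simp: sgn_div_norm)
      then show ?thesis using w by (auto intro!: bcontfun_eqI simp: torus_def)
    qed
    ultimately have "y 0 = z" by (simp add: y_def X0 zx)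
    moreover have "integral_curve ?N ?\<omega> H y"
      unfolding integral_curve_def
    proof (intro allI conjI)
      fix t
      let ?p = "unit_seq 0 (P t) :: rvec" and ?w = "unit_seq 0 (cis (2 * pi * Q t)) :: cvec"
      have pw: "?p \<in> euclid 1" "?w \<in> torus 1" by (auto simp: euclid_def torus_def)
      then show "y t \<in> ?N" using X by (simp add: y_def)
      obtain hp where hp: "hp 0 = grad_p pi 0 (X t) ?p ?w"
        "\<And>\<xi> v c. hamiltonian_vector ?N ?\<omega> (ham pi 0) (X t, ?p, ?w) (\<xi>, v, c)
          \<longleftrightarrow> tangent_vector 1 (X t) ?w \<xi> v c \<and> \<xi> = cross3 (X t) (grad_x pi 0 (X t) ?p ?w) \<and>
            (\<forall>i<1. v i = - (if i = 0 then grad_q pi 0 (X t) ?p ?w else 0) \<and> dq i ?w c = hp i)"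
        using hamiltonian_vector_ham[OF X[of t] pw(2) order_refl P_open[OF pw(1)], where b = pi and s = 0]
        by blast
      let ?\<xi> = "cross3 (X t) (vector [pi * \<rho> (P t) * cos (2 * pi * Q t), pi * \<rho> (P t) * sin (2 * pi * Q t), 0])"
      let ?P' = "- (2 * pi * (pi * \<rho> (P t) * (X t $ 2 * cos (2 * pi * Q t) - X t $ 1 * sin (2 * pi * Q t))))"
      let ?Q' = "pi * deriv \<rho> (P t) * (X t $ 1 * cos (2 * pi * Q t) + X t $ 2 * sin (2 * pi * Q t))"
      let ?c = "(2 * pi * ?Q') *\<^sub>R (\<i> * cis (2 * pi * Q t))"
      have "((\<lambda>t. cis (2 * pi * Q t)) has_vector_derivative ?c) (at t)"
        unfolding has_vector_derivative_complex_iff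
        by (auto intro!: derivative_eq_intros dQ)
      then have "(y has_vector_derivative (?\<xi>, unit_seq 0 ?P', unit_seq 0 ?c)) (at t)"
        unfolding y_def[abs_def] using dX dP[of t]
        by (intro has_vector_derivative_Pair has_vector_derivative_component[OF _ bounded_linear_unit_seq])
           (auto simp: has_real_derivative_iff_has_vector_derivative)
      moreover have "hamiltonian_vector ?N ?\<omega> (ham pi 0) (X t, ?p, ?w) (?\<xi>, unit_seq 0 ?P', unit_seq 0 ?c)"
        unfolding hp(2)
      proof (intro conjI allI impI)
        show "tangent_vector 1 (X t) ?w ?\<xi> (unit_seq 0 ?P') (unit_seq 0 ?c)"
          by (simp add: tangent_vector_def dot_cross_self euclid_def)
        show "?\<xi> = cross3 (X t) (grad_x pi 0 (X t) ?p ?w)"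
          by (simp add: grad_x_def A L cosw_def sinw_def phase_def)
        fix i :: nat assume "i < 1"
        then show "apply_bcontfun (unit_seq 0 ?P') i = - (if i = 0 then grad_q pi 0 (X t) ?p ?w else 0)"
          by (simp add: grad_q_def A L u2_def cosw_def sinw_def phase_def)
        have "dq 0 ?w (unit_seq 0 ?c) = ?Q' * ((cos (2 * pi * Q t))\<^sup>2 + (sin (2 * pi * Q t))\<^sup>2)"
          by (simp add: dq_def field_simps power2_eq_square del: sin_cos_squared_add sin_cos_squared_add2)
        then have "dq 0 ?w (unit_seq 0 ?c) = ?Q'" by simp
        with \<open>i < 1\<close> show "dq i ?w (unit_seq 0 ?c) = hp i"
          by (simp add: hp(1) grad_p_def A L u1_def cosw_def sinw_def phase_def)
      qed
      ultimately show "\<exists>V. hamiltonian_vector ?N ?\<omega> (H t) (y t) V \<and> (y has_vector_derivative V) (at t)"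
        unfolding H_def y_def by blast
    qed
    ultimately show ?thesis by blast
  qed
  then obtain y where y: "\<And>z. z \<in> ?N \<Longrightarrow> y z 0 = z \<and> integral_curve ?N ?\<omega> H (y z)"
    by metis
  then have "hamiltonian_isotopy ?N ?\<omega> H (\<lambda>t z. y z t)"
    by (simp add: hamiltonian_isotopy_def)
  moreover have "(?N \<inter> closure ?Z) \<inter> (\<lambda>z. y z 1) ` ?Z = {}"
  proof -
    have "continuous_on UNIV (\<lambda>z::(real^3) \<times> (rvec \<times> cvec). apply_bcontfun (fst (snd z)) 0)"
      by (intro bounded_linear.continuous_on[OF bounded_linear_apply_bcontfun] continuous_intros)
    then have "closed {z::(real^3) \<times> (rvec \<times> cvec). apply_bcontfun (fst (snd z)) 0 = 0}"
      by (intro closed_Collect_eq continuous_on_const)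
    then have cl: "closure ?Z \<subseteq> {z. apply_bcontfun (fst (snd z)) 0 = 0}"
      by (intro closure_minimal) auto
    have away: "apply_bcontfun (fst (snd (y z 1))) 0 \<noteq> 0" if z: "z \<in> ?Z" for z
    proof -
      have zN: "z \<in> ?N" and z3: "fst z $ 3 \<noteq> 0" and z0: "fst (snd z) = 0"
        using z \<epsilon> by (auto simp: C_eps_def euclid_def)
      have ic: "y z 0 = z" "integral_curve ?N ?\<omega> H (y z)" using y[OF zN] by auto
      \<comment> \<open>The orbit read with constant speed b = pi, so B(t) = pi t; as the phase is
        zero, \<open>ham_s\<close> lets s be 2 pi t.\<close>
      have rf: "reduced_flow (A (fst (snd (y z 0)))) (L (fst (snd (y z 0)))) (\<lambda>_. 0) (deriv (\<lambda>_. 0))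
        (deriv (deriv (\<lambda>_. 0))) (\<lambda>_. 0) (deriv (\<lambda>_. 0)) \<rho> (deriv \<rho>) (\<lambda>_. pi) (\<lambda>t. pi * t)
        (\<lambda>t. fst (y z t) $ 1) (\<lambda>t. fst (y z t) $ 2) (\<lambda>t. fst (y z t) $ 3)
        (\<lambda>t. apply_bcontfun (fst (snd (y z t))) 0) (\<lambda>t. Re (apply_bcontfun (snd (snd (y z t))) 0))
        (\<lambda>t. Im (apply_bcontfun (snd (snd (y z t))) 0))"
      proof (rule reduced_flow[OF order_refl P_open])
        fix t
        show "y z t \<in> ?N" using ic(2) by (simp add: integral_curve_def)
        show "\<exists>V. hamiltonian_vector ?N ?\<omega> (ham pi (2 * pi * t)) (y z t) V \<and> (y z has_vector_derivative V) (at t)"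
          using ic(2) unfolding integral_curve_def H_def ham_s[of pi "2 * pi * t"] by blast
      qed (auto intro!: derivative_eq_intros)
      have "apply_bcontfun (fst (snd (y z 1))) 0 = apply_bcontfun (fst (snd (y z 0))) 0 - 4 * pi * fst (y z 0) $ 3"
        by (rule reduced_flow.half_turn(2)[OF rf, of 1])
           (use M(2) z0 in \<open>auto simp: L ic(1) \<rho>_def\<close>)
      then show ?thesis using z3 by (simp add: ic(1) z0)
    qed
    then have "(\<lambda>z. y z 1) ` ?Z \<inter> {z. apply_bcontfun (fst (snd z)) 0 = 0} = {}" by auto
    then show ?thesis using cl by (metis (no_types, lifting) Int_commute disjoint_iff IntD2 subsetD)
  qed
  ultimately show ?thesis
    unfolding stably_displaceable_def displaceable_def by (intro bexI exI conjI)
qed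

theorem proposition8p1:
  shows "(\<forall>\<epsilon>>0. stably_displaceable sphere2 area_form (C_eps \<epsilon>)) \<and>
    (\<exists>E>0. \<forall>\<epsilon>>0. \<forall>(n::nat) (R::nat \<Rightarrow> real) (e::nat \<Rightarrow> int).
       (\<forall>i<n. R i > 0) \<longrightarrow> (\<exists>k<n. R k > E \<and> e k \<noteq> 0) \<longrightarrow>
       capacity sphere2 area_form (C_eps \<epsilon>) n R e = \<infinity>)"
  using C_eps_stably_displaceable capacity_infinite by metis

end
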